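(* Let $p$ be a prime, $1<r<\infty$, $\alpha>0$ and $\lambda\ge0$, and let $$\mathscr{D}^pf(x)=\int_{\mathbb{Q}_p^*}\frac{(|x|_p|y|_p)^{\lambda/2}}{\max\{|x|_p,|y|_p\}^{\lambda+1}}f(y)\,dy,\qquad x\in\mathbb{Q}_p^*.$$ If $-\frac{\lambda}{2}<1/r+\alpha<\frac{\lambda}{2}+1$, then there is a constant $C>0$ such that for any $f\in\mathfrak{B}_{r,\alpha}(\mathbb{Q}_p^* )$, $$\|\mathscr{D}^pf\|_{\mathfrak{B}_{r,\alpha}(\mathbb{Q}_p^* )}\le C\,\|f\|_{\mathfrak{B}_{r,\alpha}(\mathbb{Q}_p^* )}.$$
   Context: $\mathbb{Q}_p$ is the field of $p$-adic numbers with absolute value $|\cdot|_p$, and $\mathbb{Q}_p^*=\mathbb{Q}_p\setminus\{0\}$. $dx$ is the Haar measure on the additive group $\mathbb{Q}_p$ normalized so that $\{|x|_p\le1\}$ has measure $1$, and $|E|$ denotes the Haar measure of $E$. For $n\in\mathbb{Z}$, $B^n=\{x\in\mathbb{Q}_p:|x|_p\le p^n\}$, so $|B^n|=p^n$. A function $a:\mathbb{Q}_p^*\to\mathbb{C}$ is a central $(r,\alpha)$-block if there exists $n\in\mathbb{Z}$ such that $\operatorname{supp}a\subset B^n$ and $\|a\|_{L^r}\le|B^n|^{-\alpha}$. The block space $\mathfrak{B}_{r,\alpha}(\mathbb{Q}_p^* )$ is the set of all $f\in L^r_{\mathrm{loc}}(\mathbb{Q}_p^* )$ that can be written as $f=\sum_{k=1}^\infty\lambda_ka_k$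 (almost everywhere) with scalars $\lambda_k$ satisfying $\sum_k|\lambda_k|<\infty$ and each $a_k$ a central $(r,\alpha)$-block; its norm is $\|f\|_{\mathfrak{B}_{r,\alpha}(\mathbb{Q}_p^* )}=\inf\sum_{k=1}^\infty|\lambda_k|$, the infimum being over all such decompositions of $f$. (The scalars $\lambda_k$ are unrelated to the parameter $\lambda$.) *)

theory Defs
  imports "HOL-Analysis.Analysis" "HOL-Computational_Algebra.Primes"
begin

section \<open>The field of \<open>p\<close>-adic numbers\<close>

text \<open>
  The prime \<open>p\<close> enters through a type variable: \<open>'p padic\<close> is the field \<open>Q\<^sub>p\<close> for \<open>p = CARD('p)\<close>,
  where \<open>'p\<close> ranges over all types whose number of elements is prime.
\<close>

class prime_card =
  assumes prime_card: "prime CARD('a)"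

instance bool :: prime_card
  by standard simp

text \<open>\<open>rat_pabs p\<close> is the usual \<open>p\<close>-adic absolute value on the rationals, \<open>p\<close> to the power \<open>-v\<^sub>p(q)\<close>.\<close>

definition rat_pabs :: "nat \<Rightarrow> rat \<Rightarrow> real" where
  "rat_pabs p q = (if q = 0 then 0 else
     (case quotient_of q of (a, b) \<Rightarrow>
        real p powi (int (multiplicity (int p) b) - int (multiplicity (int p) a))))"

lemma rat_pabs_divide:
  assumes "prime p" "a \<noteq> 0" "b \<noteq> 0"
  shows "rat_pabs p (of_int a / of_int b) =
    real p powi (int (multiplicity (int p) b) - int (multiplicity (int p) a))"
proof -
  obtain c d where cd: "quotient_of (of_int a / of_int b) = (c, d)"
    by (cases "quotient_of (of_int a / of_int b)") auto
  have d: "d > 0"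
    using quotient_of_denom_pos[OF cd] .
  have eq: "(of_int a / of_int b :: rat) = of_int c / of_int d"
    using quotient_of_div[OF cd] .
  hence "of_int (a * d) = (of_int (c * b) :: rat)"
    using assms d by (simp add: field_simps)
  hence ad: "a * d = c * b"
    by (simp only: of_int_eq_iff)
  hence c: "c \<noteq> 0"
    using assms d by auto
  have pe: "prime_elem (int p)"
    using assms by auto
  have "multiplicity (int p) (a * d) = multiplicity (int p) (c * b)"
    by (simp only: ad)
  hence "multiplicity (int p) a + multiplicity (int p) d =
      multiplicity (int p) c + multiplicity (int p) b"
    using assms c d by (simp add: prime_elem_multiplicity_mult_distrib[OF pe])
  hence "int (multiplicity (int p) d) - int (multiplicity (int p) c) =
      int (multiplicity (int p) b) - int (multiplicity (int p) a)"
    by linarith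
  thus ?thesis
    using assms by (simp add: rat_pabs_def cd)
qed

lemma rat_cases_quotient:
  fixes q :: rat
  obtains a b :: int where "b \<noteq> 0" "q = of_int a / of_int b"
proof -
  obtain a b where ab: "quotient_of q = (a, b)"
    by (cases "quotient_of q") auto
  show ?thesis
    using that[of b a] quotient_of_div[OF ab] quotient_of_denom_pos[OF ab] by simp
qed

lemma rat_pabs_0 [simp]: "rat_pabs p 0 = 0"
  by (simp add: rat_pabs_def)

lemma rat_pabs_nonneg [simp]: "0 \<le> rat_pabs p q"
  by (simp add: rat_pabs_def split: prod.split)

lemma rat_pabs_eq_0_iff: "prime p \<Longrightarrow> rat_pabs p q = 0 \<longleftrightarrow> q = 0"
  by (auto simp: rat_pabs_def split: prod.splits if_splits dest: prime_gt_0_nat)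

lemma rat_pabs_minus [simp]:
  assumes "prime p"
  shows "rat_pabs p (- q) = rat_pabs p q"
proof (cases "q = 0")
  case False
  obtain a b where ab: "b \<noteq> 0" "q = of_int a / of_int b"
    by (rule rat_cases_quotient)
  have "- q = of_int (- a) / of_int b"
    using ab by simp
  moreover have "a \<noteq> 0"
    using False ab by auto
  moreover have "multiplicity (int p) (- a) = multiplicity (int p) a"
    using multiplicity_times_unit_right[of "-1" "int p" a] by simp
  ultimately show ?thesis
    using rat_pabs_divide[OF assms, of "- a" b] rat_pabs_divide[OF assms, of a b] ab by simp
qed simp

lemma rat_pabs_minus_commute: "prime p \<Longrightarrow> rat_pabs p (x - y) = rat_pabs p (y - x)"
  using rat_pabs_minus[of p "x - y"] by simp

lemma rat_pabs_mult:
  assumes "prime p"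
  shows "rat_pabs p (x * y) = rat_pabs p x * rat_pabs p y"
proof (cases "x = 0 \<or> y = 0")
  case False
  obtain a b where ab: "b \<noteq> 0" "x = of_int a / of_int b"
    by (rule rat_cases_quotient)
  obtain c d where cd: "d \<noteq> 0" "y = of_int c / of_int d"
    by (rule rat_cases_quotient)
  have nz: "a \<noteq> 0" "c \<noteq> 0"
    using False ab cd by auto
  have pe: "prime_elem (int p)" and p: "real p \<noteq> 0"
    using assms by (auto dest: prime_gt_0_nat)
  have "x * y = of_int (a * c) / of_int (b * d)"
    using ab cd by simp
  hence "rat_pabs p (x * y) = real p powi
      (int (multiplicity (int p) (b * d)) - int (multiplicity (int p) (a * c)))"
    using rat_pabs_divide[OF assms, of "a * c" "b * d"] ab cd nz by simp
  also have "\<dots> = real p powi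
      ((int (multiplicity (int p) b) - int (multiplicity (int p) a)) +
       (int (multiplicity (int p) d) - int (multiplicity (int p) c)))"
    using ab cd nz by (simp add: prime_elem_multiplicity_mult_distrib[OF pe] algebra_simps)
  also have "\<dots> = rat_pabs p x * rat_pabs p y"
    using p rat_pabs_divide[OF assms, of a b] rat_pabs_divide[OF assms, of c d] ab cd nz
    by (simp add: power_int_add)
  finally show ?thesis .
qed auto

lemma rat_pabs_1 [simp]: "prime p \<Longrightarrow> rat_pabs p 1 = 1"
  using rat_pabs_divide[of p 1 1] by simp

lemma rat_pabs_inverse:
  assumes "prime p"
  shows "rat_pabs p (inverse x) = inverse (rat_pabs p x)"
proof (cases "x = 0")
  case False
  have "rat_pabs p x * rat_pabs p (inverse x) = 1"
    using rat_pabs_mult[OF assms, of x "inverse x"] False assms by simp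
  thus ?thesis
    by (metis inverse_unique)
qed simp

lemma rat_pabs_ultrametric:
  assumes "prime p"
  shows "rat_pabs p (x + y) \<le> max (rat_pabs p x) (rat_pabs p y)"
proof (cases "x = 0 \<or> y = 0 \<or> x + y = 0")
  case True
  thus ?thesis by (auto simp: max_def)
next
  case False
  obtain a0 b0 where ab: "b0 \<noteq> 0" "x = of_int a0 / of_int b0"
    by (rule rat_cases_quotient)
  obtain c0 d0 where cd: "d0 \<noteq> 0" "y = of_int c0 / of_int d0"
    by (rule rat_cases_quotient)
  define a b c where "a = a0 * d0" and "b = c0 * b0" and "c = b0 * d0"
  have c: "c \<noteq> 0" and x: "x = of_int a / of_int c" and y: "y = of_int b / of_int c"
    using ab cd by (auto simp: a_def b_def c_def)
  have xy: "x + y = of_int (a + b) / of_int c"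
    by (simp add: x y add_divide_distrib)
  have nz: "a \<noteq> 0" "b \<noteq> 0" "a + b \<noteq> 0"
    using False xy x y by auto
  let ?m = "multiplicity (int p)"
  have "int p ^ min (?m a) (?m b) dvd a + b"
    by (intro dvd_add multiplicity_dvd') auto
  hence m: "min (?m a) (?m b) \<le> ?m (a + b)"
    using assms nz by (intro multiplicity_geI) (auto dest: prime_gt_1_nat)
  have p: "real p \<ge> 1"
    using prime_gt_1_nat[OF assms] by simp
  note eqs = rat_pabs_divide[OF assms nz(1) c, folded x] rat_pabs_divide[OF assms nz(2) c, folded y]
    rat_pabs_divide[OF assms nz(3) c, folded xy]
  show ?thesis
  proof (cases "?m a \<le> ?m b")
    case True
    hence "rat_pabs p (x + y) \<le> rat_pabs p x"
      unfolding eqs using m p by (intro power_int_increasing) auto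
    thus ?thesis by simp
  next
    case False
    hence "rat_pabs p (x + y) \<le> rat_pabs p y"
      unfolding eqs using m p by (intro power_int_increasing) auto
    thus ?thesis by simp
  qed
qed

lemma rat_pabs_triangle:
  assumes "prime p"
  shows "rat_pabs p (x + y) \<le> rat_pabs p x + rat_pabs p y"
  using rat_pabs_ultrametric[OF assms, of x y] rat_pabs_nonneg[of p x] rat_pabs_nonneg[of p y]
  by linarith

lemma rat_pabs_diff_le:
  assumes "prime p"
  shows "\<bar>rat_pabs p x - rat_pabs p y\<bar> \<le> rat_pabs p (x - y)"
  using rat_pabs_triangle[OF assms, of "x - y" y] rat_pabs_triangle[OF assms, of "y - x" x]
    rat_pabs_minus_commute[OF assms, of x y] by simp

text \<open>\<open>Q\<^sub>p\<close> is the completion of the rationals: \<open>p\<close>-adic Cauchy sequences modulo \<open>p\<close>-adic null sequences.\<close>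

definition pnull :: "nat \<Rightarrow> (nat \<Rightarrow> rat) \<Rightarrow> bool" where
  "pnull p X \<longleftrightarrow> (\<lambda>n. rat_pabs p (X n)) \<longlonglongrightarrow> 0"

definition pcauchy :: "nat \<Rightarrow> (nat \<Rightarrow> rat) \<Rightarrow> bool" where
  "pcauchy p X \<longleftrightarrow> (\<forall>e>0. \<exists>N. \<forall>m\<ge>N. \<forall>n\<ge>N. rat_pabs p (X m - X n) < e)"

definition padic_rel :: "nat \<Rightarrow> (nat \<Rightarrow> rat) \<Rightarrow> (nat \<Rightarrow> rat) \<Rightarrow> bool" where
  "padic_rel p X Y \<longleftrightarrow> pcauchy p X \<and> pcauchy p Y \<and> pnull p (\<lambda>n. X n - Y n)"

lemma pnull_bound:
  assumes "\<And>n. rat_pabs p (X n) \<le> u n" "u \<longlonglongrightarrow> 0"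
  shows "pnull p X"
  unfolding pnull_def
  by (rule tendsto_sandwich[OF _ _ tendsto_const assms(2)]) (use assms(1) in auto)

lemma pnull_add:
  assumes "prime p" "pnull p X" "pnull p Y"
  shows "pnull p (\<lambda>n. X n + Y n)"
  using tendsto_add[OF assms(2,3)[unfolded pnull_def]]
  by (intro pnull_bound[where u = "\<lambda>n. rat_pabs p (X n) + rat_pabs p (Y n)"])
    (auto intro: rat_pabs_triangle[OF assms(1)])

lemma pnull_minus: "prime p \<Longrightarrow> pnull p X \<Longrightarrow> pnull p (\<lambda>n. - X n)"
  by (simp add: pnull_def)

lemma pcauchy_const [simp]: "pcauchy p (\<lambda>n. c)"
  by (simp add: pcauchy_def)

lemma pcauchy_add:
  assumes "prime p" "pcauchy p X" "pcauchy p Y"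
  shows "pcauchy p (\<lambda>n. X n + Y n)"
  unfolding pcauchy_def
proof (intro allI impI)
  fix e :: real
  assume e: "e > 0"
  obtain M where M: "\<And>m n. m \<ge> M \<Longrightarrow> n \<ge> M \<Longrightarrow> rat_pabs p (X m - X n) < e"
    using assms(2) e unfolding pcauchy_def by blast
  obtain N where N: "\<And>m n. m \<ge> N \<Longrightarrow> n \<ge> N \<Longrightarrow> rat_pabs p (Y m - Y n) < e"
    using assms(3) e unfolding pcauchy_def by blast
  have "rat_pabs p (X m + Y m - (X n + Y n)) < e" if "m \<ge> max M N" "n \<ge> max M N" for m n
  proof -
    have "rat_pabs p (X m + Y m - (X n + Y n)) \<le> max (rat_pabs p (X m - X n)) (rat_pabs p (Y m - Y n))"
      unfolding add_diff_add by (rule rat_pabs_ultrametric[OF assms(1)])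
    also have "\<dots> < e"
      using M[of m n] N[of m n] that by simp
    finally show ?thesis .
  qed
  thus "\<exists>N. \<forall>m\<ge>N. \<forall>n\<ge>N. rat_pabs p (X m + Y m - (X n + Y n)) < e"
    by blast
qed

lemma pcauchy_minus:
  assumes "prime p" "pcauchy p X"
  shows "pcauchy p (\<lambda>n. - X n)"
proof -
  have "rat_pabs p (- X m - - X n) = rat_pabs p (X m - X n)" for m n
    using rat_pabs_minus_commute[OF assms(1), of "X n" "X m"] by simp
  thus ?thesis
    using assms(2) by (simp add: pcauchy_def)
qed

lemma pcauchy_abs_convergent:
  assumes "prime p" "pcauchy p X"
  shows "convergent (\<lambda>n. rat_pabs p (X n))"
proof -
  have "Cauchy (\<lambda>n. rat_pabs p (X n))"
    unfolding Cauchy_def dist_real_def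
  proof (intro allI impI)
    fix e :: real
    assume "e > 0"
    then obtain N where "\<forall>m\<ge>N. \<forall>n\<ge>N. rat_pabs p (X m - X n) < e"
      using assms(2) unfolding pcauchy_def by blast
    thus "\<exists>N. \<forall>m\<ge>N. \<forall>n\<ge>N. \<bar>rat_pabs p (X m) - rat_pabs p (X n)\<bar> < e"
      by (intro exI[of _ N] allI impI le_less_trans[OF rat_pabs_diff_le[OF assms(1)]]) auto
  qed
  thus ?thesis
    by (simp add: Cauchy_convergent_iff)
qed

lemma pcauchy_bounded:
  assumes "prime p" "pcauchy p X"
  obtains B where "B > 0" "\<And>n. rat_pabs p (X n) \<le> B"
proof -
  have "Bseq (\<lambda>n. rat_pabs p (X n))"
    using pcauchy_abs_convergent[OF assms] by (rule convergent_imp_Bseq)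
  then obtain B where "B > 0" "\<And>n. norm (rat_pabs p (X n)) \<le> B"
    by (auto simp: Bseq_def)
  thus ?thesis
    using that by simp
qed

lemma pnull_mult:
  assumes "prime p" "pnull p X" "pcauchy p Y"
  shows "pnull p (\<lambda>n. X n * Y n)"
proof -
  obtain B where B: "\<And>n. rat_pabs p (Y n) \<le> B"
    by (rule pcauchy_bounded[OF assms(1,3)]) blast
  have "(\<lambda>n. rat_pabs p (X n) * B) \<longlonglongrightarrow> 0"
    using tendsto_mult_right[OF assms(2)[unfolded pnull_def], of B] by simp
  thus ?thesis
    by (rule pnull_bound[rotated]) (simp add: rat_pabs_mult[OF assms(1)] mult_left_mono[OF B])
qed

lemma pcauchy_mult:
  assumes "prime p" "pcauchy p X" "pcauchy p Y"
  shows "pcauchy p (\<lambda>n. X n * Y n)"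
  unfolding pcauchy_def
proof (intro allI impI)
  fix e :: real
  assume e: "e > 0"
  obtain B where B: "B > 0" "\<And>n. rat_pabs p (X n) \<le> B"
    by (rule pcauchy_bounded[OF assms(1,2)]) blast
  obtain C where C: "C > 0" "\<And>n. rat_pabs p (Y n) \<le> C"
    by (rule pcauchy_bounded[OF assms(1,3)]) blast
  obtain M where M: "\<And>m n. m \<ge> M \<Longrightarrow> n \<ge> M \<Longrightarrow> rat_pabs p (X m - X n) < e / C"
    using assms(2) divide_pos_pos[OF e C(1)] unfolding pcauchy_def by blast
  obtain N where N: "\<And>m n. m \<ge> N \<Longrightarrow> n \<ge> N \<Longrightarrow> rat_pabs p (Y m - Y n) < e / B"
    using assms(3) divide_pos_pos[OF e B(1)] unfolding pcauchy_def by blast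
  have "rat_pabs p (X m * Y m - X n * Y n) < e" if mn: "m \<ge> max M N" "n \<ge> max M N" for m n
  proof -
    have "rat_pabs p (X m * (Y m - Y n)) \<le> B * rat_pabs p (Y m - Y n)"
      by (simp add: rat_pabs_mult[OF assms(1)] mult_right_mono[OF B(2)])
    also have "\<dots> < e"
      using N[of m n] mn B by (simp add: field_simps)
    finally have 1: "rat_pabs p (X m * (Y m - Y n)) < e" .
    have "rat_pabs p ((X m - X n) * Y n) \<le> rat_pabs p (X m - X n) * C"
      by (simp add: rat_pabs_mult[OF assms(1)] mult_left_mono[OF C(2)])
    also have "\<dots> < e"
      using M[of m n] mn C by (simp add: field_simps)
    finally have 2: "rat_pabs p ((X m - X n) * Y n) < e" .
    have "X m * Y m - X n * Y n = X m * (Y m - Y n) + (X m - X n) * Y n"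
      by (simp add: algebra_simps)
    also have "rat_pabs p \<dots> \<le> max (rat_pabs p (X m * (Y m - Y n))) (rat_pabs p ((X m - X n) * Y n))"
      by (rule rat_pabs_ultrametric[OF assms(1)])
    also have "\<dots> < e"
      using 1 2 by simp
    finally show ?thesis .
  qed
  thus "\<exists>N. \<forall>m\<ge>N. \<forall>n\<ge>N. rat_pabs p (X m * Y m - X n * Y n) < e"
    by blast
qed

lemma pcauchy_not_null:
  assumes "prime p" "pcauchy p X" "\<not> pnull p X"
  obtains b N where "b > 0" "\<And>n. n \<ge> N \<Longrightarrow> b < rat_pabs p (X n)"
proof -
  obtain L where L: "(\<lambda>n. rat_pabs p (X n)) \<longlonglongrightarrow> L"
    using pcauchy_abs_convergent[OF assms(1,2)] by (auto simp: convergent_def)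
  have "L \<ge> 0"
    by (rule LIMSEQ_le_const[OF L]) auto
  moreover have "L \<noteq> 0"
    using L assms(3) by (auto simp: pnull_def)
  ultimately have "L > 0"
    by simp
  hence "eventually (\<lambda>n. L / 2 < rat_pabs p (X n)) sequentially"
    using order_tendstoD(1)[OF L, of "L / 2"] by simp
  thus ?thesis
    using that[of "L / 2"] \<open>L > 0\<close> by (auto simp: eventually_sequentially)
qed

lemma pcauchy_inverse:
  assumes "prime p" "pcauchy p X" "\<not> pnull p X"
  shows "pcauchy p (\<lambda>n. inverse (X n))"
  unfolding pcauchy_def
proof (intro allI impI)
  fix e :: real
  assume e: "e > 0"
  obtain b M where b: "b > 0" "\<And>n. n \<ge> M \<Longrightarrow> b < rat_pabs p (X n)"
    by (rule pcauchy_not_null[OF assms]) blast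
  obtain N where N: "\<And>m n. m \<ge> N \<Longrightarrow> n \<ge> N \<Longrightarrow> rat_pabs p (X m - X n) < e * b * b"
    using assms(2) mult_pos_pos[OF mult_pos_pos[OF e b(1)] b(1)] unfolding pcauchy_def by blast
  have "rat_pabs p (inverse (X m) - inverse (X n)) < e"
    if mn: "m \<ge> max M N" "n \<ge> max M N" for m n
  proof -
    have bm: "b < rat_pabs p (X m)" "b < rat_pabs p (X n)"
      using mn b by auto
    hence nz: "X m \<noteq> 0" "X n \<noteq> 0"
      using b(1) by auto
    have bb: "b * b \<le> rat_pabs p (X m) * rat_pabs p (X n)"
      using bm b(1) by (intro mult_mono) auto
    have "inverse (X m) - inverse (X n) = (X n - X m) * (inverse (X m) * inverse (X n))"
      using nz by (simp add: field_simps)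
    hence "rat_pabs p (inverse (X m) - inverse (X n)) =
        rat_pabs p (X n - X m) / (rat_pabs p (X m) * rat_pabs p (X n))"
      by (simp only: rat_pabs_mult[OF assms(1)] rat_pabs_inverse[OF assms(1)] divide_inverse
          inverse_mult_distrib)
    also have "\<dots> \<le> rat_pabs p (X n - X m) / (b * b)"
      using bb b(1) by (intro divide_left_mono) (auto intro!: mult_pos_pos less_le_trans[OF _ bb])
    also have "\<dots> < e"
      using N[of n m] mn b(1) by (simp add: field_simps)
    finally show ?thesis .
  qed
  thus "\<exists>N. \<forall>m\<ge>N. \<forall>n\<ge>N. rat_pabs p (inverse (X m) - inverse (X n)) < e"
    by blast
qed

lemma part_equivp_padic_rel:
  assumes "prime p"
  shows "part_equivp (padic_rel p)"
proof (rule part_equivpI)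
  show "\<exists>X. padic_rel p X X"
    by (rule exI[of _ "\<lambda>_. 0"]) (simp add: padic_rel_def pnull_def)
  show "symp (padic_rel p)"
    by (auto simp: symp_def padic_rel_def dest: pnull_minus[OF assms])
  show "transp (padic_rel p)"
    unfolding transp_def padic_rel_def
  proof (intro allI impI, elim conjE, intro conjI)
    fix X Y Z
    assume "pnull p (\<lambda>n. X n - Y n)" "pnull p (\<lambda>n. Y n - Z n)"
    from pnull_add[OF assms this] show "pnull p (\<lambda>n. X n - Z n)"
      by simp
  qed
qed

typedef (overloaded) ('a::prime_card) padic =
    "{c. \<exists>X. pcauchy CARD('a) X \<and> c = {Y. padic_rel CARD('a) X Y}}"
  morphisms padic_class padic_of_class
  by (rule exI[of _ "{Y. padic_rel CARD('a) (\<lambda>_. 0) Y}"]) (auto intro!: exI[of _ "\<lambda>_. 0"])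

definition padic_of_seq :: "(nat \<Rightarrow> rat) \<Rightarrow> 'a::prime_card padic" where
  "padic_of_seq X = padic_of_class {Y. padic_rel CARD('a) X Y}"

definition seq_of_padic :: "'a::prime_card padic \<Rightarrow> nat \<Rightarrow> rat" where
  "seq_of_padic x = (SOME X. X \<in> padic_class x)"

definition cr_padic :: "(nat \<Rightarrow> rat) \<Rightarrow> 'a::prime_card padic \<Rightarrow> bool" where
  "cr_padic X x \<longleftrightarrow> padic_rel CARD('a) X X \<and> padic_of_seq X = x"

lemma padic_rel_refl_iff: "padic_rel p X X \<longleftrightarrow> pcauchy p X"
  by (simp add: padic_rel_def pnull_def)

lemma Quotient_padic:
  "Quotient (padic_rel CARD('a)) padic_of_seq seq_of_padic
     (cr_padic :: _ \<Rightarrow> 'a::prime_card padic \<Rightarrow> bool)"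
proof (rule QuotientI)
  note pe = part_equivp_padic_rel[OF prime_card[where 'a='a]]
  note sym = part_equivp_symp[OF pe] and trans = part_equivp_transp[OF pe]
  have class_eq: "{Z. padic_rel CARD('a) X Z} = {Z. padic_rel CARD('a) Y Z}"
    if "padic_rel CARD('a) X Y" for X Y
    using that by (auto intro: sym trans)
  have cls: "padic_class (padic_of_seq X :: 'a padic) = {Y. padic_rel CARD('a) X Y}"
    if "pcauchy CARD('a) X" for X
    unfolding padic_of_seq_def using that by (intro padic_of_class_inverse) auto
  have rep: "pcauchy CARD('a) (seq_of_padic x) \<and> padic_of_seq (seq_of_padic x) = x" for x :: "'a padic"
  proof -
    obtain X where X: "pcauchy CARD('a) X" "padic_class x = {Y. padic_rel CARD('a) X Y}"
      using padic_class[of x] by auto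
    have "X \<in> padic_class x"
      using X by (simp add: padic_rel_refl_iff)
    hence "seq_of_padic x \<in> padic_class x"
      unfolding seq_of_padic_def by (rule someI[where P = "\<lambda>X. X \<in> padic_class x"])
    hence r: "padic_rel CARD('a) X (seq_of_padic x)"
      using X by simp
    have "padic_of_seq (seq_of_padic x) = x"
      unfolding padic_of_seq_def class_eq[OF r, symmetric] X(2)[symmetric] by (rule padic_class_inverse)
    thus ?thesis
      using r by (simp add: padic_rel_def)
  qed
  show "padic_of_seq (seq_of_padic x) = x" for x :: "'a padic"
    using rep by simp
  show "padic_rel CARD('a) (seq_of_padic x) (seq_of_padic x)" for x :: "'a padic"
    using rep by (simp add: padic_rel_refl_iff)
  show "padic_rel CARD('a) X Y \<longleftrightarrow> padic_rel CARD('a) X X \<and> padic_rel CARD('a) Y Y \<and>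
      (padic_of_seq X :: 'a padic) = padic_of_seq Y" for X Y
  proof
    assume "padic_rel CARD('a) X Y"
    thus "padic_rel CARD('a) X X \<and> padic_rel CARD('a) Y Y \<and>
        (padic_of_seq X :: 'a padic) = padic_of_seq Y"
      using class_eq[of X Y] by (simp add: padic_of_seq_def padic_rel_refl_iff)
        (simp add: padic_rel_def)
  next
    assume *: "padic_rel CARD('a) X X \<and> padic_rel CARD('a) Y Y \<and>
        (padic_of_seq X :: 'a padic) = padic_of_seq Y"
    hence "{Z. padic_rel CARD('a) X Z} = {Z. padic_rel CARD('a) Y Z}"
      using cls[of X] cls[of Y] by (simp add: padic_rel_refl_iff)
    thus "padic_rel CARD('a) X Y"
      using * by blast
  qed
  show "cr_padic = (\<lambda>X x. padic_rel CARD('a) X X \<and> (padic_of_seq X :: 'a padic) = x)"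
    by (intro ext) (simp add: cr_padic_def)
qed

setup_lifting Quotient_padic

instantiation padic :: (prime_card) field
begin

lift_definition zero_padic :: "'a padic" is "\<lambda>_. 0"
  by (simp add: padic_rel_def pnull_def)

lift_definition one_padic :: "'a padic" is "\<lambda>_. 1"
  by (simp add: padic_rel_def pnull_def)

lift_definition plus_padic :: "'a padic \<Rightarrow> 'a padic \<Rightarrow> 'a padic" is "\<lambda>X Y n. X n + Y n"
  unfolding padic_rel_def add_diff_add
  by (intro conjI pcauchy_add pnull_add prime_card) auto

lift_definition uminus_padic :: "'a padic \<Rightarrow> 'a padic" is "\<lambda>X n. - X n"
  unfolding padic_rel_def minus_diff_minus
  by (intro conjI pcauchy_minus pnull_minus prime_card) auto

lift_definition times_padic :: "'a padic \<Rightarrow> 'a padic \<Rightarrow> 'a padic" is "\<lambda>X Y n. X n * Y n"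
  subgoal premises prems for X X' Y Y'
  proof -
    have "pnull CARD('a) (\<lambda>n. (X n - X' n) * Y n + (Y n - Y' n) * X' n)"
      using prems unfolding padic_rel_def by (intro pnull_add pnull_mult prime_card) auto
    thus ?thesis
      using prems unfolding padic_rel_def by (auto intro!: pcauchy_mult prime_card simp: algebra_simps)
  qed
  done

lift_definition inverse_padic :: "'a padic \<Rightarrow> 'a padic"
  is "\<lambda>X. if pnull CARD('a) X then (\<lambda>_. 0) else (\<lambda>n. inverse (X n))"
  subgoal premises prems for X Y
  proof -
    note [simp] = prime_card[where 'a='a]
    have X: "pcauchy CARD('a) X" and Y: "pcauchy CARD('a) Y"
      and XY: "pnull CARD('a) (\<lambda>n. X n - Y n)"
      using prems by (auto simp: padic_rel_def)
    have YX: "pnull CARD('a) (\<lambda>n. Y n - X n)"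
      using pnull_minus[OF prime_card XY] by simp
    have iff: "pnull CARD('a) X \<longleftrightarrow> pnull CARD('a) Y"
      using pnull_add[OF prime_card XY, of Y] pnull_add[OF prime_card YX, of X] by auto
    show ?thesis
    proof (cases "pnull CARD('a) X")
      case True
      thus ?thesis using iff by (simp add: padic_rel_def pnull_def)
    next
      case False
      hence nY: "\<not> pnull CARD('a) Y" using iff by simp
      have iX: "pcauchy CARD('a) (\<lambda>n. inverse (X n))"
        by (rule pcauchy_inverse[OF prime_card X False])
      have iY: "pcauchy CARD('a) (\<lambda>n. inverse (Y n))"
        by (rule pcauchy_inverse[OF prime_card Y nY])
      have null: "pnull CARD('a) (\<lambda>n. (Y n - X n) * (inverse (X n) * inverse (Y n)))"
        by (intro pnull_mult[OF prime_card YX] pcauchy_mult[OF prime_card] iX iY)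
      obtain b M where b: "b > 0" "\<And>n. n \<ge> M \<Longrightarrow> b < rat_pabs CARD('a) (X n)"
        by (rule pcauchy_not_null[OF prime_card X False]) blast
      obtain c N where c: "c > 0" "\<And>n. n \<ge> N \<Longrightarrow> c < rat_pabs CARD('a) (Y n)"
        by (rule pcauchy_not_null[OF prime_card Y nY]) blast
      have "eventually (\<lambda>n. rat_pabs CARD('a) ((Y n - X n) * (inverse (X n) * inverse (Y n))) =
          rat_pabs CARD('a) (inverse (X n) - inverse (Y n))) sequentially"
        using eventually_ge_at_top[of "max M N"]
      proof eventually_elim
        case (elim n)
        have "X n \<noteq> 0" "Y n \<noteq> 0"
          using b(1) b(2)[of n] c(1) c(2)[of n] elim by auto
        thus ?case
          by (intro arg_cong[where f = "rat_pabs _"]) (simp add: field_simps)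
      qed
      hence "pnull CARD('a) (\<lambda>n. inverse (X n) - inverse (Y n))"
        using null unfolding pnull_def by (rule Lim_transform_eventually[rotated])
      thus ?thesis
        using False nY iX iY by (simp add: padic_rel_def)
    qed
  qed
  done

definition minus_padic :: "'a padic \<Rightarrow> 'a padic \<Rightarrow> 'a padic" where
  "minus_padic x y = x + - y"

definition divide_padic :: "'a padic \<Rightarrow> 'a padic \<Rightarrow> 'a padic" where
  "divide_padic x y = x * inverse y"

instance
proof
  fix a b c :: "'a padic"
  show "a + b + c = a + (b + c)"
    by transfer (simp add: pcauchy_add prime_card padic_rel_def pnull_def add.assoc)
  show "a + b = b + a"
    by transfer (simp add: pcauchy_add prime_card padic_rel_def pnull_def add.commute)
  show "0 + a = a"
    by transfer (simp add: padic_rel_def pnull_def)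
  show "- a + a = 0"
    by transfer (simp add: padic_rel_def pnull_def)
  show "a - b = a + - b"
    by (simp add: minus_padic_def)
  show "a * b * c = a * (b * c)"
    by transfer (simp add: pcauchy_mult prime_card padic_rel_def pnull_def mult.assoc)
  show "a * b = b * a"
    by transfer (simp add: pcauchy_mult prime_card padic_rel_def pnull_def mult.commute)
  show "1 * a = a"
    by transfer (simp add: padic_rel_def pnull_def)
  show "(a + b) * c = a * c + b * c"
    by transfer (simp add: pcauchy_add pcauchy_mult prime_card padic_rel_def pnull_def distrib_right)
  show "(0::'a padic) \<noteq> 1"
    by transfer (simp add: padic_rel_def pnull_def prime_card LIMSEQ_const_iff)
  show "inverse (0::'a padic) = 0"
    by transfer (simp add: padic_rel_def pnull_def)
  show "a div b = a * inverse b"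
    by (simp add: divide_padic_def)
  show "inverse a * a = 1" if "a \<noteq> 0"
    using that
  proof transfer
    fix X :: "nat \<Rightarrow> rat"
    assume "padic_rel CARD('a) X X" "\<not> padic_rel CARD('a) X (\<lambda>_. 0)"
    hence X: "pcauchy CARD('a) X" "\<not> pnull CARD('a) X"
      by (auto simp: padic_rel_def)
    obtain b M where b: "b > 0" "\<And>n. n \<ge> M \<Longrightarrow> b < rat_pabs CARD('a) (X n)"
      by (rule pcauchy_not_null[OF prime_card X]) blast
    have "eventually (\<lambda>n. 0 = rat_pabs CARD('a) (inverse (X n) * X n - 1)) sequentially"
      using eventually_ge_at_top[of M]
    proof eventually_elim
      case (elim n)
      have "X n \<noteq> 0"
        using b(1) b(2)[of n] elim by auto
      thus ?case by simp
    qed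
    hence "pnull CARD('a) (\<lambda>n. inverse (X n) * X n - 1)"
      unfolding pnull_def by (rule Lim_transform_eventually[OF tendsto_const])
    thus "padic_rel CARD('a) (\<lambda>n. (if pnull CARD('a) X then \<lambda>_. 0 else (\<lambda>n. inverse (X n))) n * X n)
        (\<lambda>_. 1)"
      using X by (simp add: padic_rel_def pcauchy_mult pcauchy_inverse prime_card)
  qed
qed

end

lift_definition padic_abs :: "'p::prime_card padic \<Rightarrow> real"
  is "\<lambda>X. lim (\<lambda>n. rat_pabs CARD('p) (X n))"
  subgoal premises prems for X Y
  proof -
    have X: "pcauchy CARD('p) X" and Y: "pcauchy CARD('p) Y"
      and XY: "pnull CARD('p) (\<lambda>n. X n - Y n)"
      using prems by (auto simp: padic_rel_def)
    have lX: "(\<lambda>n. rat_pabs CARD('p) (X n)) \<longlonglongrightarrow> lim (\<lambda>n. rat_pabs CARD('p) (X n))"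
      using pcauchy_abs_convergent[OF prime_card X] by (simp add: convergent_LIMSEQ_iff)
    have "\<forall>n. norm (rat_pabs CARD('p) (Y n) - rat_pabs CARD('p) (X n)) \<le> rat_pabs CARD('p) (X n - Y n)"
      unfolding real_norm_def rat_pabs_minus_commute[OF prime_card[where 'a='p], of "X _"]
      by (intro allI rat_pabs_diff_le prime_card)
    hence "(\<lambda>n. rat_pabs CARD('p) (Y n) - rat_pabs CARD('p) (X n)) \<longlonglongrightarrow> 0"
      by (intro Lim_null_comparison[OF always_eventually XY[unfolded pnull_def]])
    from tendsto_add[OF this lX]
    show ?thesis
      by (simp add: limI)
  qed
  done

lemma padic_abs_tendsto:
  assumes "pcauchy CARD('p::prime_card) X"
  shows "(\<lambda>n. rat_pabs CARD('p) (X n)) \<longlonglongrightarrow> lim (\<lambda>n. rat_pabs CARD('p) (X n))"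
  using pcauchy_abs_convergent[OF prime_card assms] by (simp add: convergent_LIMSEQ_iff)

lemma padic_abs_eq_0_iff [simp]: "padic_abs x = 0 \<longleftrightarrow> x = 0"
proof (transfer, goal_cases)
  case (1 X)
  hence X: "pcauchy CARD('a) X"
    by (simp add: padic_rel_def)
  have "lim (\<lambda>n. rat_pabs CARD('a) (X n)) = 0 \<longleftrightarrow> (\<lambda>n. rat_pabs CARD('a) (X n)) \<longlonglongrightarrow> 0"
    using padic_abs_tendsto[OF X] by (metis limI)
  thus ?case
    using X by (simp add: padic_rel_def pnull_def)
qed

lemma padic_abs_ultrametric: "padic_abs (x + y) \<le> max (padic_abs x) (padic_abs y)"
proof (transfer, goal_cases)
  case (1 X Y)
  hence X: "pcauchy CARD('a) X" and Y: "pcauchy CARD('a) Y"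
    by (simp_all add: padic_rel_def)
  show ?case
    by (rule LIMSEQ_le[OF padic_abs_tendsto[OF pcauchy_add[OF prime_card X Y]]
          tendsto_max[OF padic_abs_tendsto[OF X] padic_abs_tendsto[OF Y]]])
      (use rat_pabs_ultrametric[OF prime_card[where 'a='a]] in blast)
qed

lemma padic_abs_nonneg [simp]: "0 \<le> padic_abs x"
proof (transfer, goal_cases)
  case (1 X)
  hence "pcauchy CARD('a) X"
    by (simp add: padic_rel_def)
  from padic_abs_tendsto[OF this] show ?case
    by (rule LIMSEQ_le_const) auto
qed

lemma padic_abs_minus [simp]: "padic_abs (- x) = padic_abs x"
  by transfer (simp add: prime_card)

lemma padic_abs_minus_commute: "padic_abs (x - y) = padic_abs (y - x)"
  using padic_abs_minus[of "x - y"] by simp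

text \<open>The topology and the Borel sets of \<open>Q\<^sub>p\<close> are those of the metric \<open>|x - y|\<^sub>p\<close>.\<close>

instantiation padic :: (prime_card) metric_space
begin

definition dist_padic :: "'a padic \<Rightarrow> 'a padic \<Rightarrow> real" where
  "dist_padic x y = padic_abs (x - y)"

definition uniformity_padic :: "('a padic \<times> 'a padic) filter" where
  "uniformity_padic = (INF e\<in>{0<..}. principal {(x, y). dist x y < e})"

definition open_padic :: "'a padic set \<Rightarrow> bool" where
  "open_padic U \<longleftrightarrow> (\<forall>x\<in>U. eventually (\<lambda>(x', y). x' = x \<longrightarrow> y \<in> U) uniformity)"

instance
proof
  fix x y z :: "'a padic"
  show "dist x y = 0 \<longleftrightarrow> x = y"
    by (simp add: dist_padic_def)
  show "dist x y \<le> dist x z + dist y z"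
    using padic_abs_ultrametric[of "x - z" "z - y"] padic_abs_minus_commute[of z y]
      padic_abs_nonneg[of "x - z"] padic_abs_nonneg[of "y - z"]
    unfolding dist_padic_def diff_add_cancel add_diff_eq by linarith
qed (simp_all add: uniformity_padic_def open_padic_def)

end

section \<open>Haar measure\<close>

text \<open>\<open>B\<^sup>n\<close>\<close>

definition padic_ball :: "int \<Rightarrow> 'p::prime_card padic set" where
  "padic_ball n = {x. padic_abs x \<le> real CARD('p) powi n}"

text \<open>
  The normalization makes \<open>M\<close> nonzero and finite on compact sets, so these are exactly the conditions
  for \<open>M\<close> to be the normalized Haar measure; regularity is automatic on this space.
\<close>

definition padic_haar_measure :: "'p::prime_card padic measure \<Rightarrow> bool" where
  "padic_haar_measure M \<longleftrightarrow>
     sets M = sets borel \<and>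
     (\<forall>a. \<forall>E\<in>sets M. emeasure M ((+) a ` E) = emeasure M E) \<and>
     emeasure M {x. padic_abs x \<le> 1} = 1"

section \<open>Block spaces\<close>

text \<open>
  Functions on the punctured field are represented by functions on the whole field, whose value at
  \<open>0\<close> never matters: they are only ever considered with respect to the measure below.
\<close>

definition punctured :: "'p::prime_card padic measure \<Rightarrow> 'p padic measure" where
  "punctured M = restrict_space M (- {0})"

definition in_Lr :: "'a measure \<Rightarrow> real \<Rightarrow> ('a \<Rightarrow> complex) \<Rightarrow> bool" where
  "in_Lr N r f \<longleftrightarrow> f \<in> borel_measurable N \<and> integrable N (\<lambda>x. cmod (f x) powr r)"

definition Lr_norm :: "'a measure \<Rightarrow> real \<Rightarrow> ('a \<Rightarrow> complex) \<Rightarrow> real" where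
  "Lr_norm N r f = (\<integral>x. cmod (f x) powr r \<partial>N) powr (1 / r)"

definition in_Lr_loc :: "'p::prime_card padic measure \<Rightarrow> real \<Rightarrow> ('p padic \<Rightarrow> complex) \<Rightarrow> bool" where
  "in_Lr_loc M r f \<longleftrightarrow> f \<in> borel_measurable (punctured M) \<and>
     (\<forall>K. compact K \<and> K \<subseteq> - {0} \<longrightarrow> set_integrable (punctured M) K (\<lambda>x. cmod (f x) powr r))"

text \<open>The support is the closure, relative to the punctured field, of the set where the function is nonzero.\<close>

definition punctured_supp :: "('p::prime_card padic \<Rightarrow> complex) \<Rightarrow> 'p padic set" where
  "punctured_supp f = closure {x. x \<noteq> 0 \<and> f x \<noteq> 0} - {0}"

definition central_block ::
    "'p::prime_card padic measure \<Rightarrow> real \<Rightarrow> real \<Rightarrow> ('p padic \<Rightarrow> complex) \<Rightarrow> bool" where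
  "central_block M r \<alpha> a \<longleftrightarrow> (\<exists>n::int.
     punctured_supp a \<subseteq> padic_ball n \<and>
     in_Lr (punctured M) r a \<and>
     Lr_norm (punctured M) r a \<le> measure M (padic_ball n :: 'p padic set) powr (- \<alpha>))"

definition block_decomposition ::
    "'p::prime_card padic measure \<Rightarrow> real \<Rightarrow> real \<Rightarrow> ('p padic \<Rightarrow> complex) \<Rightarrow>
     (nat \<Rightarrow> complex) \<Rightarrow> (nat \<Rightarrow> 'p padic \<Rightarrow> complex) \<Rightarrow> bool" where
  "block_decomposition M r \<alpha> f c a \<longleftrightarrow>
     summable (\<lambda>k. cmod (c k)) \<and>
     (\<forall>k. central_block M r \<alpha> (a k)) \<and>
     (AE x in punctured M. (\<lambda>k. c k * a k x) sums f x)"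

definition block_space ::
    "'p::prime_card padic measure \<Rightarrow> real \<Rightarrow> real \<Rightarrow> ('p padic \<Rightarrow> complex) set" where
  "block_space M r \<alpha> = {f. in_Lr_loc M r f \<and> (\<exists>c a. block_decomposition M r \<alpha> f c a)}"

definition block_norm ::
    "'p::prime_card padic measure \<Rightarrow> real \<Rightarrow> real \<Rightarrow> ('p padic \<Rightarrow> complex) \<Rightarrow> real" where
  "block_norm M r \<alpha> f = Inf {(\<Sum>k. cmod (c k)) | c a. block_decomposition M r \<alpha> f c a}"

section \<open>The operator\<close>

definition D_kernel :: "real \<Rightarrow> 'p::prime_card padic \<Rightarrow> 'p padic \<Rightarrow> real" where
  "D_kernel l x y =
     (padic_abs x * padic_abs y) powr (l / 2) / max (padic_abs x) (padic_abs y) powr (l + 1)"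

definition D_op ::
    "'p::prime_card padic measure \<Rightarrow> real \<Rightarrow> ('p padic \<Rightarrow> complex) \<Rightarrow> 'p padic \<Rightarrow> complex" where
  "D_op M l f x = (\<integral>y. complex_of_real (D_kernel l x y) * f y \<partial>punctured M)"

end

theory Submission
  imports Defs
begin

text \<open>
  Put \<open>\<beta> = 1/r + \<alpha>\<close> and \<open>W f = \<integral> |y|\<^bsup>\<beta>-1\<^esup> |f y| dy\<close>. Since \<open>\<alpha> > 0\<close>, \<open>W\<close> is bounded on central blocks, so \<open>W f\<close> is
  at most a constant times the block norm of \<open>f\<close>. The image of \<open>f\<close> under the operator depends only
  on \<open>|x|\<close>, hence is the sum over integers \<open>m\<close> of \<open>c\<^sub>m b\<^sub>m\<close>, where \<open>b\<^sub>m\<close> is the block that equals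
  \<open>p\<^bsup>-m\<beta>\<^esup>\<close> on the sphere \<open>|x| = p\<^bsup>m\<^esup>\<close> and vanishes elsewhere. By Tonelli, \<open>\<Sum>\<^sub>m |c\<^sub>m|\<close> is at most a constant times
  \<open>W f\<close>: the bounds on \<open>\<beta>\<close> make \<open>\<Sum>\<^sub>m p\<^bsup>m\<beta>\<^esup> K(p\<^bsup>m\<^esup>, |y|)\<close> a two-sided geometric series of order \<open>|y|\<^bsup>\<beta>-1\<^esup>\<close>.
\<close>

section \<open>Absolute value and Haar measure of balls\<close>

lift_definition padic_of_rat :: "rat \<Rightarrow> 'p::prime_card padic" is "\<lambda>q n. q"
  by (simp add: padic_rel_def pnull_def)

lemma padic_abs_of_rat: "padic_abs (padic_of_rat q :: 'p::prime_card padic) = rat_pabs CARD('p) q"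
  by transfer simp

lemma padic_of_rat_diff: "padic_of_rat (q - s) = padic_of_rat q - padic_of_rat s"
proof -
  have "padic_of_rat (q - s) + padic_of_rat s = padic_of_rat q"
    by transfer (simp add: padic_rel_def pnull_def)
  thus ?thesis
    by (metis add_diff_cancel_right')
qed

lemma padic_abs_mult: "padic_abs (x * y) = padic_abs x * padic_abs y"
proof (transfer, goal_cases)
  case (1 X Y)
  hence X: "pcauchy CARD('a) X" and Y: "pcauchy CARD('a) Y"
    by (simp_all add: padic_rel_def)
  have "(\<lambda>n. rat_pabs CARD('a) (X n * Y n)) \<longlonglongrightarrow>
      lim (\<lambda>n. rat_pabs CARD('a) (X n)) * lim (\<lambda>n. rat_pabs CARD('a) (Y n))"
    unfolding rat_pabs_mult[OF prime_card]
    by (intro tendsto_mult padic_abs_tendsto X Y)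
  thus ?case
    by (rule limI)
qed

text \<open>A late term of a Cauchy sequence representing x is a rational close to x.\<close>

lemma padic_of_rat_dense:
  fixes x :: "'p::prime_card padic"
  assumes "e > 0"
  obtains q where "padic_abs (x - padic_of_rat q) < e"
proof -
  \<comment> \<open>Written with \<open>+\<close> and unary minus, the operations that transfer to
    sequences; binary subtraction is derived from them.\<close>
  have "\<exists>q. padic_abs (x + - padic_of_rat q) < e"
  proof (transfer fixing: e, goal_cases)
    case (1 X)
    hence X: "pcauchy CARD('p) X"
      by (simp add: padic_rel_def)
    obtain N where N: "\<And>m n. m \<ge> N \<Longrightarrow> n \<ge> N \<Longrightarrow> rat_pabs CARD('p) (X m - X n) < e / 2"
      using X assms unfolding pcauchy_def by (meson half_gt_zero)
    \<comment> \<open>The margin \<open>e / 2\<close> is there because a strict bound on the terms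
      becomes non-strict in the limit.\<close>
    have "lim (\<lambda>n. rat_pabs CARD('p) (X n + - X N)) \<le> e / 2"
      using N[of _ N]
      by (intro LIMSEQ_le_const2[OF padic_abs_tendsto[OF pcauchy_add[OF prime_card X pcauchy_const]]])
        (auto intro!: exI[of _ N] less_imp_le)
    thus ?case
      using assms by (intro exI[of _ "X N"]) simp
  qed
  thus ?thesis
    using that by auto
qed

text \<open>Isosceles principle: in an ultrametric the two largest sides of a triangle are
  equal.\<close>

lemma padic_abs_eqI_of_close:
  assumes "padic_abs (x - y) < padic_abs x"
  shows "padic_abs y = padic_abs x"
proof (rule antisym)
  show "padic_abs y \<le> padic_abs x"
    using padic_abs_ultrametric[of "y - x" x] assms padic_abs_minus_commute[of x y] by simp
  show "padic_abs x \<le> padic_abs y"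
    using padic_abs_ultrametric[of "x - y" y] assms by auto
qed

section \<open>The value group: integer powers of p\<close>

lemma powi_le_iff: "1 < a \<Longrightarrow> a powi m \<le> a powi n \<longleftrightarrow> m \<le> n"
  for a :: "'a :: linordered_field"
  by (meson less_imp_le not_le power_int_increasing power_int_strict_increasing)

lemma powi_less_iff: "1 < a \<Longrightarrow> a powi m < a powi n \<longleftrightarrow> m < n"
  for a :: "'a :: linordered_field"
  by (meson not_le powi_le_iff)

lemma card_gt_1: "1 < real CARD('p::prime_card)"
  using prime_gt_1_nat[OF prime_card[where 'a='p]] by simp

text \<open>By density and the isosceles principle, x shares its absolute value with a nearby
  rational, where it is a power of p by definition.\<close>

lemma padic_abs_values:
  fixes x :: "'p::prime_card padic"
  assumes "x \<noteq> 0"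
  obtains n where "padic_abs x = real CARD('p) powi n"
proof -
  have "padic_abs x > 0"
    using assms padic_abs_nonneg[of x] by (simp add: less_le)
  then obtain q where "padic_abs (x - padic_of_rat q) < padic_abs x"
    by (rule padic_of_rat_dense)
  hence eq: "rat_pabs CARD('p) q = padic_abs x"
    using padic_abs_eqI_of_close padic_abs_of_rat by metis
  hence "q \<noteq> 0"
    using assms by auto
  thus ?thesis
    using that eq[symmetric] by (auto simp: rat_pabs_def split: prod.splits)
qed

text \<open>Since the values are discrete, an open ball is the closed ball of the next smaller
  radius.\<close>

lemma padic_abs_less_powi_iff:
  fixes x :: "'p::prime_card padic"
  shows "padic_abs x < real CARD('p) powi n \<longleftrightarrow> padic_abs x \<le> real CARD('p) powi (n - 1)"
proof (cases "x = 0")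
  case True
  hence "padic_abs x = 0"
    by simp
  thus ?thesis
    using card_gt_1[where 'p='p] by (simp only: zero_less_power_int zero_le_power_int less_imp_le
        less_trans[OF zero_less_one])
next
  case False
  then obtain k where "padic_abs x = real CARD('p) powi k"
    by (rule padic_abs_values)
  thus ?thesis
    using card_gt_1[where 'p='p]
    by (simp add: powi_less_iff powi_le_iff)
qed

lemma padic_abs_surj:
  obtains z :: "'p::prime_card padic" where "padic_abs z = real CARD('p) powi n"
proof -
  let ?p = "int CARD('p)"
  have p: "?p \<noteq> 0" "\<not> is_unit ?p" "real CARD('p) > 0"
    using card_gt_1[where 'p='p] by auto
  \<comment> \<open>The rational p^(-n) has absolute value p^n; the sign of n decides whether the
    power stands in the denominator or in the numerator.\<close>
  have "\<exists>q. rat_pabs CARD('p) q = real CARD('p) powi n"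
  proof (cases "n \<ge> 0")
    case True
    show ?thesis
      using rat_pabs_divide[OF prime_card[where 'a='p], of 1 "?p ^ nat n"] p True
      by (intro exI[of _ "of_int 1 / of_int (?p ^ nat n)"])
        (simp add: multiplicity_same_power' power_int_def)
  next
    case False
    show ?thesis
      using rat_pabs_divide[OF prime_card[where 'a='p], of "?p ^ nat (- n)" 1] p False
      by (intro exI[of _ "of_int (?p ^ nat (- n)) / of_int 1"])
        (simp add: multiplicity_same_power' power_int_def)
  qed
  thus ?thesis
    using that padic_abs_of_rat by metis
qed

section \<open>The residue field: reduction modulo p\<close>

lemma rat_pabs_of_int_less_1_iff:
  assumes "prime p"
  shows "rat_pabs p (of_int a) < 1 \<longleftrightarrow> int p dvd a"
proof (cases "a = 0")
  case False
  have p: "real p > 1"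
    using prime_gt_1_nat[OF assms] by simp
  have "rat_pabs p (of_int a) = real p powi (- int (multiplicity (int p) a))"
    using rat_pabs_divide[OF assms False, of 1] by simp
  also have "\<dots> < 1 \<longleftrightarrow> multiplicity (int p) a > 0"
    using p powi_less_iff[OF p, of "- int (multiplicity (int p) a)" 0] by simp
  also have "\<dots> \<longleftrightarrow> int p dvd a"
    using False assms by (simp add: prime_multiplicity_gt_zero_iff)
  finally show ?thesis .
qed simp

text \<open>Some rational a/b lies at distance less than 1 from x, hence has absolute value at most
  1. In lowest terms its denominator is prime to p, so a/b is congruent modulo p to an integer
  c.\<close>

lemma padic_residue:
  fixes x :: "'p::prime_card padic"
  assumes "padic_abs x \<le> 1"
  obtains c where "c < CARD('p)" "padic_abs (x - padic_of_rat (of_nat c)) < 1"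
proof -
  let ?p = "CARD('p)"
  note pr = prime_card[where 'a='p]
  obtain q where q: "padic_abs (x - padic_of_rat q) < 1"
    using padic_of_rat_dense[of 1] by auto
  have q1: "rat_pabs ?p q \<le> 1"
    using padic_abs_ultrametric[of "padic_of_rat q - x" x] q assms
      padic_abs_minus_commute[of x "padic_of_rat q"] by (simp add: padic_abs_of_rat)
  obtain a b where ab: "quotient_of q = (a, b)"
    by (cases "quotient_of q")
  have b0: "b > 0" and qab: "q = of_int a / of_int b" and cop: "coprime a b"
    using quotient_of_denom_pos[OF ab] quotient_of_div[OF ab] quotient_of_coprime[OF ab] by auto
  \<comment> \<open>If p divided b, then |a| = |q| |b| < 1 would force p to divide a as well,
    against coprimality.\<close>
  have nb: "\<not> int ?p dvd b"
  proof
    assume d: "int ?p dvd b"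
    have na: "\<not> int ?p dvd a"
      using coprime_common_divisor[OF cop _ d] card_gt_1[where 'p='p] by auto
    have "of_int a = q * of_int b"
      using qab b0 by simp
    hence "rat_pabs ?p (of_int a) = rat_pabs ?p q * rat_pabs ?p (of_int b)"
      by (metis rat_pabs_mult[OF pr])
    also have "\<dots> \<le> 1 * rat_pabs ?p (of_int b)"
      by (intro mult_right_mono q1) simp
    also have "\<dots> < 1"
      using d by (simp add: rat_pabs_of_int_less_1_iff[OF pr])
    finally show False
      using na by (simp add: rat_pabs_of_int_less_1_iff[OF pr])
  qed
  have "coprime b (int ?p)"
    using nb pr prime_imp_coprime[of "int ?p" b] by (simp add: coprime_commute)
  then obtain u v where uv: "u * b + v * int ?p = 1"
    using bezout_int[of b "int ?p"] by (auto simp: coprime_imp_gcd_eq_1)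
  \<comment> \<open>By the Bezout identity u inverts b modulo p, so c represents a/b.\<close>
  define c where "c = nat ((u * a) mod int ?p)"
  have p0: "int ?p > 0"
    using card_gt_1[where 'p='p] by simp
  have c: "c < ?p" "int c = (u * a) mod int ?p"
    using pos_mod_bound[OF p0, of "u * a"] pos_mod_sign[OF p0, of "u * a"]
    by (simp_all add: c_def nat_less_iff)
  define k where "k = (u * a) div int ?p"
  have ck: "int c = u * a - int ?p * k"
    by (simp add: c(2) k_def minus_mult_div_eq_mod)
  have "a - int c * b = a * (u * b + v * int ?p) - int c * b"
    by (simp add: uv)
  also have "\<dots> = int ?p * (a * v + k * b)"
    unfolding ck by (simp add: algebra_simps)
  finally have "int ?p dvd a - int c * b"
    by simp
  hence "rat_pabs ?p (of_int (a - int c * b)) < 1"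
    by (simp only: rat_pabs_of_int_less_1_iff[OF pr])
  moreover have "rat_pabs ?p (of_int b) = 1"
    using nb rat_pabs_of_int_less_1_iff[OF pr, of b] rat_pabs_divide[OF pr, of b 1] b0
    by (simp add: not_dvd_imp_multiplicity_0)
  moreover have "of_int (a - int c * b) = (q - of_nat c) * of_int b"
    using b0 by (simp add: qab field_simps)
  ultimately have "rat_pabs ?p (q - of_nat c) < 1"
    by (simp add: rat_pabs_mult[OF pr])
  hence "padic_abs (padic_of_rat q - padic_of_rat (of_nat c) :: 'p padic) < 1"
    by (simp flip: padic_of_rat_diff add: padic_abs_of_rat)
  hence "padic_abs (x - padic_of_rat (of_nat c)) < 1"
    using padic_abs_ultrametric[of "x - padic_of_rat q" "padic_of_rat q - padic_of_rat (of_nat c)"] q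
    by simp
  thus ?thesis
    using that c(1) by blast
qed

section \<open>Balls, their cosets and their measure\<close>

lemma continuous_padic_abs: "continuous_on UNIV (padic_abs :: 'p::prime_card padic \<Rightarrow> real)"
proof -
  have "padic_abs = (\<lambda>x :: 'p padic. dist x 0)"
    by (auto simp: dist_padic_def)
  moreover have "continuous_on UNIV (\<lambda>x :: 'p padic. dist x 0)"
    by (intro continuous_intros)
  ultimately show ?thesis
    by metis
qed

lemma borel_measurable_padic_abs [measurable]: "padic_abs \<in> borel_measurable borel"
  by (rule borel_measurable_continuous_onI[OF continuous_padic_abs])

lemma closed_padic_ball: "closed (padic_ball n)"
  unfolding padic_ball_def
  by (rule closed_Collect_le[OF continuous_padic_abs continuous_on_const])

text \<open>Recognizing translates as closed balls of the metric makes them Borel sets.\<close>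

lemma padic_ball_translate: "(+) a ` padic_ball n = cball a (real CARD('p) powi n)"
  for a :: "'p::prime_card padic"
proof (intro equalityI subsetI)
  fix x
  assume "x \<in> cball a (real CARD('p) powi n)"
  hence "x - a \<in> padic_ball n"
    by (simp add: padic_ball_def dist_padic_def padic_abs_minus_commute)
  thus "x \<in> (+) a ` padic_ball n"
    by (intro image_eqI[of _ _ "x - a"]) auto
qed (auto simp: padic_ball_def dist_padic_def)

lemma padic_ball_in_borel [measurable]: "padic_ball n \<in> sets borel"
  by (rule borel_closed[OF closed_padic_ball])

text \<open>Multiplication by z carries the unit ball onto \<open>padic_ball n\<close> and its p
  residue classes onto p cosets of \<open>padic_ball (n - 1)\<close>.\<close>

lemma padic_ball_cosets:
  fixes z :: "'p::prime_card padic"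
  assumes z: "padic_abs z = real CARD('p) powi n"
  defines "t \<equiv> \<lambda>c. padic_of_rat (of_nat c) * z"
  shows "padic_ball n = (\<Union>c<CARD('p). (+) (t c) ` padic_ball (n - 1))"
    and "disjoint_family_on (\<lambda>c. (+) (t c) ` padic_ball (n - 1)) {..<CARD('p)}"
proof -
  let ?P = "real CARD('p)"
  have P: "?P > 1" "?P powi n > 0"
    using card_gt_1[where 'p='p] by auto
  have z0: "z \<noteq> 0"
    using z P(2) padic_abs_eq_0_iff[of z] by force
  have of_nat_le: "rat_pabs CARD('p) (of_nat c) \<le> 1" for c
    using rat_pabs_divide[OF prime_card[where 'a='p], of "int c" 1] P(1)
      power_int_increasing[of "- int (multiplicity (int CARD('p)) (int c))" 0 ?P]
    by (cases "c = 0") auto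
  show "padic_ball n = (\<Union>c<CARD('p). (+) (t c) ` padic_ball (n - 1))"
  proof (intro equalityI subsetI)
    fix x :: "'p padic"
    assume "x \<in> padic_ball n"
    hence "padic_abs x \<le> ?P powi n"
      by (simp add: padic_ball_def)
    moreover have "padic_abs x = padic_abs (x / z) * ?P powi n"
      using z0 by (simp flip: z padic_abs_mult)
    ultimately have "padic_abs (x / z) \<le> 1"
      using P(2) by simp
    then obtain c where c: "c < CARD('p)" "padic_abs (x / z - padic_of_rat (of_nat c)) < 1"
      by (rule padic_residue)
    have "padic_abs (x - t c) = padic_abs (x / z - padic_of_rat (of_nat c)) * ?P powi n"
      using z0 by (simp flip: z padic_abs_mult add: t_def left_diff_distrib)
    also have "\<dots> < ?P powi n"
      using c(2) P(2) by simp
    finally have "x - t c \<in> padic_ball (n - 1)"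
      by (simp add: padic_abs_less_powi_iff padic_ball_def)
    thus "x \<in> (\<Union>c<CARD('p). (+) (t c) ` padic_ball (n - 1))"
      using c(1) by (intro UN_I[of c]) (auto intro!: image_eqI[of _ _ "x - t c"])
  next
    fix x :: "'p padic"
    assume "x \<in> (\<Union>c<CARD('p). (+) (t c) ` padic_ball (n - 1))"
    then obtain c y where x: "x = t c + y" "padic_abs y \<le> ?P powi (n - 1)"
      by (auto simp: padic_ball_def)
    have "padic_abs (t c) \<le> ?P powi n"
      using of_nat_le[of c] P(2) by (simp add: t_def padic_abs_mult padic_abs_of_rat z)
    moreover have "padic_abs y \<le> ?P powi n"
      using x(2) by (simp flip: padic_abs_less_powi_iff)
    ultimately show "x \<in> padic_ball n"
      using padic_abs_ultrametric[of "t c" y] by (simp add: padic_ball_def x)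
  qed
  show "disjoint_family_on (\<lambda>c. (+) (t c) ` padic_ball (n - 1)) {..<CARD('p)}"
    unfolding disjoint_family_on_def
  proof (intro ballI impI, rule ccontr)
    fix c d
    assume cd: "c \<in> {..<CARD('p)}" "d \<in> {..<CARD('p)}" "c \<noteq> d"
    assume "(+) (t c) ` padic_ball (n - 1) \<inter> (+) (t d) ` padic_ball (n - 1) \<noteq> {}"
    then obtain u v where uv: "t c + u = t d + v" "padic_abs u < ?P powi n" "padic_abs v < ?P powi n"
      by (auto simp: padic_ball_def padic_abs_less_powi_iff)
    \<comment> \<open>A common point gives |c - d| < 1, so p divides c - d, which is impossible for
      distinct c and d below p.\<close>
    have tt: "t c - t d = v - u"
      using uv(1) by (simp add: algebra_simps)
    have "padic_abs (v - u) < ?P powi n"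
      using uv(2,3) padic_abs_ultrametric[of v "- u"] by simp
    moreover have "t c - t d = padic_of_rat (of_int (int c - int d)) * z"
      by (simp add: t_def padic_of_rat_diff left_diff_distrib)
    ultimately have "rat_pabs CARD('p) (of_int (int c - int d)) < 1"
      using P(2) unfolding tt[symmetric] by (simp del: of_int_diff add: padic_abs_mult padic_abs_of_rat z)
    hence "int CARD('p) dvd int c - int d"
      by (simp only: rat_pabs_of_int_less_1_iff[OF prime_card[where 'a='p]])
    hence "\<bar>int CARD('p)\<bar> \<le> \<bar>int c - int d\<bar>"
      using cd(3) by (intro dvd_imp_le_int) auto
    thus False
      using cd by auto
  qed
qed

text \<open>By translation invariance the p cosets have equal measure, so passing from one radius to
  the next multiplies the measure by p. Induction in both directions starts from the normalized unit
  ball.\<close>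

lemma emeasure_padic_ball:
  fixes M :: "'p::prime_card padic measure"
  assumes "padic_haar_measure M"
  shows "emeasure M (padic_ball n) = ennreal (real CARD('p) powi n)"
proof -
  let ?P = "real CARD('p)"
  have P: "?P > 1"
    by (rule card_gt_1)
  have sets: "sets M = sets borel"
    and trans: "\<And>a E. E \<in> sets M \<Longrightarrow> emeasure M ((+) a ` E) = emeasure M E"
    and one: "emeasure M {x. padic_abs x \<le> 1} = 1"
    using assms by (auto simp: padic_haar_measure_def)
  have step: "emeasure M (padic_ball n) = ennreal ?P * emeasure M (padic_ball (n - 1))" for n
  proof -
    obtain z :: "'p padic" where z: "padic_abs z = ?P powi n"
      by (rule padic_abs_surj)
    define t where "t c = padic_of_rat (of_nat c) * z" for c
    have bs: "padic_ball (n - 1) \<in> sets M"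
      by (simp add: sets)
    have "emeasure M (padic_ball n) = (\<Sum>c<CARD('p). emeasure M ((+) (t c) ` padic_ball (n - 1)))"
      unfolding padic_ball_cosets(1)[OF z, folded t_def]
      by (rule sum_emeasure[symmetric, OF _ padic_ball_cosets(2)[OF z, folded t_def]])
        (auto simp: sets padic_ball_translate)
    also have "\<dots> = ennreal ?P * emeasure M (padic_ball (n - 1))"
      by (simp add: trans[OF bs] ennreal_of_nat_eq_real_of_nat)
    finally show ?thesis .
  qed
  show ?thesis
  proof (induction n rule: int_induct[of _ 0])
    case base
    show ?case
      using one by (simp add: padic_ball_def)
  next
    case (step1 i)
    thus ?case
      using step[of "i + 1"] P by (simp add: power_int_add flip: ennreal_mult)
  next
    case (step2 i)
    \<comment> \<open>Downwards the recursion is solved by cancelling the factor p, which is neither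
      0 nor infinite.\<close>
    have "ennreal ?P * emeasure M (padic_ball (i - 1)) = ennreal ?P * ennreal (?P powi (i - 1))"
      using step[of i] step2 P by (simp add: power_int_diff flip: ennreal_mult)
    thus ?case
      using P by (simp add: ennreal_mult_cancel_left)
  qed
qed

section \<open>A weighted integral dominated by the block norm\<close>

lemma powi_powr: "0 < a \<Longrightarrow> (a powi m) powr s = a powr (of_int m * s)"
  for a :: real
  by (simp add: powr_powr flip: powr_real_of_int')

lemma padic_abs_pos: "x \<noteq> 0 \<Longrightarrow> 0 < padic_abs x"
  using padic_abs_nonneg[of x] by (simp add: less_le)

lemma space_punctured: "padic_haar_measure M \<Longrightarrow> space (punctured M) = - {0}"
  by (auto simp: punctured_def space_restrict_space padic_haar_measure_def
      dest!: sets_eq_imp_space_eq)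

lemma measurable_punctured:
  "padic_haar_measure M \<Longrightarrow> f \<in> borel_measurable borel \<Longrightarrow> f \<in> borel_measurable (punctured M)"
  unfolding punctured_def
  by (intro measurable_restrict_space1) (simp add: padic_haar_measure_def cong: measurable_cong_sets)

lemma nn_integral_punctured_le:
  assumes "padic_haar_measure M"
  shows "(\<integral>\<^sup>+x. f x \<partial>punctured M) \<le> (\<integral>\<^sup>+x. f x \<partial>M)"
proof -
  have "- {0} \<inter> space M \<in> sets M"
    using assms sets_eq_imp_space_eq[of M borel] by (simp add: padic_haar_measure_def)
  hence "(\<integral>\<^sup>+x. f x \<partial>punctured M) = (\<integral>\<^sup>+x. f x * indicator (- {0}) x \<partial>M)"
    unfolding punctured_def by (rule nn_integral_restrict_space)
  also have "\<dots> \<le> (\<integral>\<^sup>+x. f x \<partial>M)"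
    by (intro nn_integral_mono) (auto simp: indicator_def)
  finally show ?thesis .
qed

text \<open>Summation over spheres: the one of radius p^(n-k) has measure at most p^(n-k), so the
  integral is dominated by a geometric series of ratio p^(-\<gamma>), convergent since \<gamma> >
  0.\<close>

lemma nn_integral_ball_powr:
  fixes M :: "'p::prime_card padic measure"
  assumes M: "padic_haar_measure M" and \<gamma>: "\<gamma> > 0"
  shows "(\<integral>\<^sup>+x. ennreal (padic_abs x powr (\<gamma> - 1)) * indicator (padic_ball n) x \<partial>punctured M)
    \<le> ennreal (real CARD('p) powr (of_int n * \<gamma>) / (1 - real CARD('p) powr - \<gamma>))"
proof -
  let ?P = "real CARD('p)"
  have P: "?P > 1"
    by (rule card_gt_1)
  have q: "?P powr - \<gamma> < 1"
    using P \<gamma> by (simp add: powr_minus inverse_less_1_iff)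
  have sets [measurable_cong]: "sets M = sets borel"
    using M by (simp add: padic_haar_measure_def)
  \<comment> \<open>\<open>u k\<close> is the weight on the sphere of radius p^(n-k). The sphere is
    then enlarged to a ball, so that only measures of balls occur.\<close>
  define u where "u k = ennreal (?P powr (of_int (n - int k) * (\<gamma> - 1)))" for k
  have "ennreal (padic_abs x powr (\<gamma> - 1)) * indicator (padic_ball n) x \<le>
      (\<Sum>k. u k * indicator (padic_ball (n - int k)) x)" if "x \<in> space (punctured M)" for x :: "'p padic"
  proof (cases "x \<in> padic_ball n")
    case True
    have "x \<noteq> 0"
      using that by (simp add: space_punctured[OF M])
    then obtain m where m: "padic_abs x = ?P powi m"
      by (rule padic_abs_values)
    have mn: "m \<le> n"
      using True P by (simp add: padic_ball_def m powi_le_iff)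
    \<comment> \<open>The term belonging to the sphere of x already equals the left side; the others
      are nonnegative.\<close>
    let ?k = "nat (n - m)"
    have "ennreal (padic_abs x powr (\<gamma> - 1)) = u ?k * indicator (padic_ball (n - int ?k)) x"
      using mn P by (simp add: u_def padic_ball_def m powi_powr)
    also have "\<dots> \<le> (\<Sum>k. u k * indicator (padic_ball (n - int k)) x)"
      using sum_le_suminf[of "\<lambda>k. u k * indicator (padic_ball (n - int k)) x" "{?k}"]
      by (simp only: sum.insert finite.intros empty_iff sum.empty add_0_right summableI
          not_False_eq_True simp_thms zero_le)
    finally show ?thesis
      using True by simp
  qed simp
  hence "(\<integral>\<^sup>+x. ennreal (padic_abs x powr (\<gamma> - 1)) * indicator (padic_ball n) x \<partial>punctured M)
      \<le> (\<integral>\<^sup>+x. (\<Sum>k. u k * indicator (padic_ball (n - int k)) x) \<partial>punctured M)"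
    by (rule nn_integral_mono)
  also have "\<dots> \<le> (\<integral>\<^sup>+x. (\<Sum>k. u k * indicator (padic_ball (n - int k)) x) \<partial>M)"
    by (rule nn_integral_punctured_le[OF M])
  also have "\<dots> = (\<Sum>k. \<integral>\<^sup>+x. u k * indicator (padic_ball (n - int k)) x \<partial>M)"
    by (intro nn_integral_suminf) measurable
  also have "\<dots> = (\<Sum>k. ennreal (?P powr (of_int n * \<gamma>) * (?P powr - \<gamma>) ^ k))"
  proof (intro suminf_cong)
    fix k
    have "(\<integral>\<^sup>+x. u k * indicator (padic_ball (n - int k)) x \<partial>M) = u k * ennreal (?P powi (n - int k))"
      by (simp add: nn_integral_cmult_indicator emeasure_padic_ball[OF M])
    also have "\<dots> = ennreal (?P powr (of_int (n - int k) * (\<gamma> - 1) + of_int (n - int k)))"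
      using P powi_powr[of ?P "n - int k" 1] by (simp add: u_def powr_add flip: ennreal_mult)
    also have "of_int (n - int k) * (\<gamma> - 1) + of_int (n - int k) = of_int n * \<gamma> + (- \<gamma>) * real k"
      by (simp add: algebra_simps)
    also have "?P powr \<dots> = ?P powr (of_int n * \<gamma>) * (?P powr - \<gamma>) ^ k"
      using P by (simp only: powr_add) (simp add: powr_powr flip: powr_realpow)
    finally show "(\<integral>\<^sup>+x. u k * indicator (padic_ball (n - int k)) x \<partial>M) =
        ennreal (?P powr (of_int n * \<gamma>) * (?P powr - \<gamma>) ^ k)" .
  qed
  also have "\<dots> = ennreal (\<Sum>k. ?P powr (of_int n * \<gamma>) * (?P powr - \<gamma>) ^ k)"
    using q by (intro suminf_ennreal2 summable_mult summable_geometric) auto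
  also have "(\<Sum>k. ?P powr (of_int n * \<gamma>) * (?P powr - \<gamma>) ^ k) =
      ?P powr (of_int n * \<gamma>) / (1 - ?P powr - \<gamma>)"
    using q by (simp add: suminf_mult suminf_geometric summable_geometric)
  finally show ?thesis .
qed

section \<open>Weighted integrals of blocks and of sums of blocks\<close>

text \<open>A pointwise substitute for Hoelder's inequality with a free parameter s: for t above s
  the negative exponent \<open>1 - r\<close> gives
  \<open>t powr (1 - r) \<le> s powr (1 - r)\<close>.\<close>

lemma le_plus_powr:
  fixes s t r :: real
  assumes "0 < s" "0 \<le> t" "1 < r"
  shows "t \<le> s + t powr r * s powr (1 - r)"
proof (cases "t \<le> s")
  case True
  thus ?thesis
    by (simp add: add_increasing2)
next
  case False
  have "t = t powr r * t powr (1 - r)"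
    using False assms by (simp flip: powr_add)
  also have "\<dots> \<le> t powr r * s powr (1 - r)"
    using False assms by (intro mult_left_mono powr_mono2') auto
  finally show ?thesis
    using assms by simp
qed

text \<open>Hoelder's inequality in additive form: one part is a power of |x| over the ball,
  integrable at 0 because \<alpha> > 0, and the other is controlled by the norm condition on the
  block. The scaling makes the constant independent of the ball.\<close>

lemma central_block_weighted_bound:
  fixes M :: "'p::prime_card padic measure"
  assumes M: "padic_haar_measure M" and r: "1 < r" and \<alpha>: "0 < \<alpha>"
  obtains C where "C > 0" "\<And>a. central_block M r \<alpha> a \<Longrightarrow>
    (\<integral>\<^sup>+x. ennreal (padic_abs x powr (1 / r + \<alpha> - 1) * cmod (a x)) \<partial>punctured M) \<le> ennreal C"
proof
  let ?P = "real CARD('p)"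
  \<comment> \<open>With r' the conjugate exponent of r, \<gamma> is \<alpha> r', and the r'-th
    power of the weight is |x|^(\<gamma>-1).\<close>
  define \<gamma> where "\<gamma> = \<alpha> * r / (r - 1)"
  define C where "C = 1 / (1 - ?P powr - \<gamma>)"
  have P: "?P > 1"
    by (rule card_gt_1)
  have \<gamma>: "\<gamma> > 0"
    using r \<alpha> by (simp add: \<gamma>_def)
  have "?P powr - \<gamma> < 1"
    using P \<gamma> by (simp add: powr_minus inverse_less_1_iff)
  hence C: "C > 0"
    by (simp add: C_def)
  thus "C + 1 > 0"
    by simp
  fix a :: "'p padic \<Rightarrow> complex"
  assume "central_block M r \<alpha> a"
  then obtain n where supp: "punctured_supp a \<subseteq> padic_ball n" and Lr: "in_Lr (punctured M) r a"
    and norm: "Lr_norm (punctured M) r a \<le> measure M (padic_ball n :: 'p padic set) powr (- \<alpha>)"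
    by (auto simp: central_block_def)
  define q where "q = ?P powi n"
  have q: "q > 0"
    using P by (simp add: q_def)
  define \<beta> where "\<beta> = 1 / r + \<alpha>"
  have a_meas [measurable]: "a \<in> borel_measurable (punctured M)"
    and int: "integrable (punctured M) (\<lambda>x. cmod (a x) powr r)"
    using Lr by (auto simp: in_Lr_def)
  have [measurable]: "padic_abs \<in> borel_measurable (punctured M)"
    by (intro measurable_punctured[OF M]) measurable
  have [measurable]: "indicator (padic_ball n) \<in> borel_measurable (punctured M)"
    by (intro measurable_punctured[OF M]) measurable
  define I where "I = (\<integral>x. cmod (a x) powr r \<partial>punctured M)"
  have I0: "I \<ge> 0"
    by (simp add: I_def)
  have "I powr (1 / r) \<le> q powr (- \<alpha>)"
    using norm q by (simp add: Lr_norm_def I_def measure_def emeasure_padic_ball[OF M] q_def)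
  hence "(I powr (1 / r)) powr r \<le> (q powr (- \<alpha>)) powr r"
    using r by (intro powr_mono2) auto
  hence I: "I \<le> q powr (- \<alpha> * r)"
    using r I0 by (simp add: powr_powr)
  \<comment> \<open>This is \<open>le_plus_powr\<close> times the weight, where q is the measure of
    the ball: the first summand is free of a, the second is a constant times |a|^r.\<close>
  have pt: "ennreal (padic_abs x powr (\<beta> - 1) * cmod (a x)) \<le>
      ennreal (q powr - \<gamma>) * (ennreal (padic_abs x powr (\<gamma> - 1)) * indicator (padic_ball n) x) +
      ennreal (q powr (\<alpha> * r)) * ennreal (cmod (a x) powr r)" if "x \<in> space (punctured M)" for x
  proof (cases "a x = 0")
    case False
    have x: "x \<noteq> 0"
      using that by (simp add: space_punctured[OF M])
    hence "x \<in> punctured_supp a"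
      using False closure_subset by (fastforce simp: punctured_supp_def)
    hence xb: "x \<in> padic_ball n"
      using supp by blast
    define d where "d = padic_abs x"
    \<comment> \<open>This \<open>s\<close> makes the weight times \<open>s powr (1 - r)\<close> constant in \<open>x\<close>.\<close>
    define s where "s = d powr ((\<beta> - 1) / (r - 1)) * q powr (- \<gamma>)"
    have d: "d > 0"
      using padic_abs_pos[OF x] by (simp add: d_def)
    have "s > 0"
      using d q by (simp add: s_def)
    hence "d powr (\<beta> - 1) * cmod (a x) \<le> d powr (\<beta> - 1) * (s + cmod (a x) powr r * s powr (1 - r))"
      using r by (intro mult_left_mono le_plus_powr) auto
    also have "\<dots> = d powr (\<beta> - 1) * s + (d powr (\<beta> - 1) * s powr (1 - r)) * cmod (a x) powr r"
      by (simp add: algebra_simps)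
    also have "d powr (\<beta> - 1) * s = q powr - \<gamma> * d powr ((\<beta> - 1) + (\<beta> - 1) / (r - 1))"
      by (simp add: s_def powr_add)
    also have "(\<beta> - 1) + (\<beta> - 1) / (r - 1) = \<gamma> - 1"
      using r by (simp add: \<beta>_def \<gamma>_def field_simps)
    also have "s powr (1 - r) = d powr (((\<beta> - 1) / (r - 1)) * (1 - r)) * q powr (- \<gamma> * (1 - r))"
      by (simp add: s_def powr_mult powr_powr)
    also have "((\<beta> - 1) / (r - 1)) * (1 - r) = - (\<beta> - 1)"
      using r by (simp add: field_simps)
    also have "- \<gamma> * (1 - r) = \<alpha> * r"
      using r by (simp add: \<gamma>_def field_simps)
    also have "d powr (\<beta> - 1) * (d powr (- (\<beta> - 1)) * q powr (\<alpha> * r)) = q powr (\<alpha> * r)"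
      using d by (simp flip: mult.assoc powr_add)
    finally have "ennreal (d powr (\<beta> - 1) * cmod (a x)) \<le>
        ennreal (q powr - \<gamma> * d powr (\<gamma> - 1) + q powr (\<alpha> * r) * cmod (a x) powr r)"
      by (rule ennreal_leI)
    thus ?thesis
      using xb by (simp add: d_def ennreal_plus ennreal_mult)
  qed simp
  have "(\<integral>\<^sup>+x. ennreal (padic_abs x powr (\<beta> - 1) * cmod (a x)) \<partial>punctured M) \<le>
      (\<integral>\<^sup>+x. ennreal (q powr - \<gamma>) * (ennreal (padic_abs x powr (\<gamma> - 1)) * indicator (padic_ball n) x) +
      ennreal (q powr (\<alpha> * r)) * ennreal (cmod (a x) powr r) \<partial>punctured M)"
    by (intro nn_integral_mono pt)
  also have "\<dots> = ennreal (q powr - \<gamma>) *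
        (\<integral>\<^sup>+x. ennreal (padic_abs x powr (\<gamma> - 1)) * indicator (padic_ball n) x \<partial>punctured M) +
      ennreal (q powr (\<alpha> * r)) * (\<integral>\<^sup>+x. ennreal (cmod (a x) powr r) \<partial>punctured M)"
    by (simp add: nn_integral_add nn_integral_cmult)
  also have "\<dots> \<le> ennreal (q powr - \<gamma>) * ennreal (?P powr (of_int n * \<gamma>) / (1 - ?P powr - \<gamma>)) +
      ennreal (q powr (\<alpha> * r)) * ennreal (q powr (- \<alpha> * r))"
    using I by (intro add_mono mult_left_mono nn_integral_ball_powr[OF M \<gamma>])
      (auto simp: nn_integral_eq_integral[OF int] I_def[symmetric] intro: ennreal_leI)
  also have "\<dots> = ennreal (q powr - \<gamma> * (q powr \<gamma> * C) + q powr (\<alpha> * r) * q powr (- \<alpha> * r))"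
    using C P by (simp add: C_def q_def powi_powr ennreal_plus flip: ennreal_mult)
  \<comment> \<open>The powers of q cancel, so the two parts contribute C and 1 whatever the
    ball.\<close>
  also have "q powr - \<gamma> * (q powr \<gamma> * C) + q powr (\<alpha> * r) * q powr (- \<alpha> * r) = C + 1"
    using q by (simp flip: mult.assoc powr_add)
  finally show "(\<integral>\<^sup>+x. ennreal (padic_abs x powr (1 / r + \<alpha> - 1) * cmod (a x)) \<partial>punctured M)
      \<le> ennreal (C + 1)"
    by (simp add: \<beta>_def)
qed

text \<open>Countable subadditivity of a weighted L1 seminorm: a bound uniform over blocks passes to
  sums of blocks at the price of the sum of the |c k|.\<close>

lemma decomposition_weighted_bound:
  assumes bound: "\<And>a. central_block M r \<alpha> a \<Longrightarrow>
      (\<integral>\<^sup>+x. ennreal (w x * cmod (a x)) \<partial>punctured M) \<le> ennreal C"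
    and C: "C \<ge> 0" and w: "\<And>x. w x \<ge> 0" "w \<in> borel_measurable (punctured M)"
    and dec: "block_decomposition M r \<alpha> f c a"
  shows "(\<integral>\<^sup>+x. ennreal (w x * cmod (f x)) \<partial>punctured M) \<le> ennreal (C * (\<Sum>k. cmod (c k)))"
proof -
  note [measurable] = w(2)
  have sm: "summable (\<lambda>k. cmod (c k))" and blk: "\<And>k. central_block M r \<alpha> (a k)"
    and sums: "AE x in punctured M. (\<lambda>k. c k * a k x) sums f x"
    using dec by (auto simp: block_decomposition_def)
  have [measurable]: "a k \<in> borel_measurable (punctured M)" for k
    using blk[of k] by (auto simp: central_block_def in_Lr_def)
  have "AE x in punctured M. ennreal (w x * cmod (f x)) \<le>
      (\<Sum>k. ennreal (cmod (c k)) * ennreal (w x * cmod (a k x)))"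
    using sums
  proof eventually_elim
    case (elim x)
    let ?S = "\<Sum>k. ennreal (cmod (c k)) * ennreal (w x * cmod (a k x))"
    \<comment> \<open>The triangle inequality holds for partial sums and passes to the pointwise
      limit.\<close>
    have "(\<lambda>n. ennreal (w x * cmod (\<Sum>k<n. c k * a k x))) \<longlonglongrightarrow> ennreal (w x * cmod (f x))"
      using elim unfolding sums_def by (intro tendsto_intros)
    moreover have "ennreal (w x * cmod (\<Sum>k<n. c k * a k x)) \<le> ?S" for n
    proof -
      have "w x * cmod (\<Sum>k<n. c k * a k x) \<le> w x * (\<Sum>k<n. cmod (c k * a k x))"
        by (intro mult_left_mono norm_sum w)
      also have "\<dots> = (\<Sum>k<n. cmod (c k) * (w x * cmod (a k x)))"
        by (simp add: sum_distrib_left norm_mult algebra_simps)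
      finally have "ennreal (w x * cmod (\<Sum>k<n. c k * a k x)) \<le>
          ennreal (\<Sum>k<n. cmod (c k) * (w x * cmod (a k x)))"
        by (rule ennreal_leI)
      also have "\<dots> = (\<Sum>k<n. ennreal (cmod (c k)) * ennreal (w x * cmod (a k x)))"
        using w(1) by (simp add: ennreal_mult flip: sum_ennreal)
      also have "\<dots> \<le> ?S"
        by (rule sum_le_suminf) auto
      finally show ?thesis .
    qed
    ultimately show ?case
      by (intro LIMSEQ_le_const2) auto
  qed
  hence "(\<integral>\<^sup>+x. ennreal (w x * cmod (f x)) \<partial>punctured M) \<le>
      (\<integral>\<^sup>+x. (\<Sum>k. ennreal (cmod (c k)) * ennreal (w x * cmod (a k x))) \<partial>punctured M)"
    by (rule nn_integral_mono_AE)
  also have "\<dots> = (\<Sum>k. ennreal (cmod (c k)) * (\<integral>\<^sup>+x. ennreal (w x * cmod (a k x)) \<partial>punctured M))"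
    by (simp add: nn_integral_suminf nn_integral_cmult)
  also have "\<dots> \<le> (\<Sum>k. ennreal (cmod (c k)) * ennreal C)"
    by (intro suminf_le mult_left_mono bound blk) auto
  also have "\<dots> = ennreal (\<Sum>k. cmod (c k) * C)"
    using C sm by (subst suminf_ennreal2[symmetric]) (auto simp: ennreal_mult intro: summable_mult2)
  also have "(\<Sum>k. cmod (c k) * C) = C * (\<Sum>k. cmod (c k))"
    using suminf_mult2[OF sm, of C] by (simp add: mult.commute)
  finally show ?thesis .
qed

section \<open>Decomposing the image into spheres\<close>

text \<open>The kernel depends only on the two absolute values; this profile can be evaluated at a
  radius p^m without choosing a point of the sphere.\<close>

definition radial_kernel :: "real \<Rightarrow> real \<Rightarrow> real \<Rightarrow> real" where
  "radial_kernel l u v = (u * v) powr (l / 2) / max u v powr (l + 1)"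

lemma D_kernel_eq_radial: "D_kernel l x y = radial_kernel l (padic_abs x) (padic_abs y)"
  by (simp add: D_kernel_def radial_kernel_def)

lemma radial_kernel_nonneg: "0 \<le> radial_kernel l u v"
  by (simp add: radial_kernel_def)

text \<open>All factors are powers of p, so exponents are compared. The left exponent is i
  (\<beta>-1) minus (l/2+1-\<beta>)(m-i) if i \<le> m, and minus (\<beta>+l/2)(i-m) otherwise;
  \<delta> is the smaller of the two decay rates.\<close>

lemma radial_kernel_powi_le:
  fixes p l \<beta> :: real and m i :: int
  assumes p: "p > 1"
  defines "\<delta> \<equiv> min (\<beta> + l / 2) (l / 2 + 1 - \<beta>)"
  shows "p powr (of_int m * \<beta>) * radial_kernel l (p powi m) (p powi i) \<le>
    (p powi i) powr (\<beta> - 1) * (p powr - \<delta>) powr of_int \<bar>m - i\<bar>"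
proof -
  have max: "max (p powi m) (p powi i) = p powi (max m i)"
    using p by (simp add: max_def powi_le_iff)
  have "radial_kernel l (p powi m) (p powi i) =
      p powr (of_int (m + i) * (l / 2)) / p powr (of_int (max m i) * (l + 1))"
    using p by (simp add: radial_kernel_def max powi_powr flip: power_int_add)
  hence "p powr (of_int m * \<beta>) * radial_kernel l (p powi m) (p powi i) =
      p powr (of_int m * \<beta> + of_int (m + i) * (l / 2) - of_int (max m i) * (l + 1))"
    by (simp only: powr_add[of p] powr_diff[of p] times_divide_eq_right)
  also have "\<dots> \<le> p powr (of_int i * (\<beta> - 1) - \<delta> * of_int \<bar>m - i\<bar>)"
  proof (intro powr_mono)
    show "of_int m * \<beta> + of_int (m + i) * (l / 2) - of_int (max m i) * (l + 1) \<le>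
        of_int i * (\<beta> - 1) - \<delta> * of_int \<bar>m - i\<bar>"
    proof (cases "i \<le> m")
      case True
      have "\<delta> * of_int (m - i) \<le> (l / 2 + 1 - \<beta>) * of_int (m - i)"
        using True by (intro mult_right_mono) (auto simp: \<delta>_def)
      thus ?thesis
        using True by (simp add: algebra_simps max_def add_divide_distrib diff_divide_distrib)
    next
      case False
      have "\<delta> * of_int (i - m) \<le> (\<beta> + l / 2) * of_int (i - m)"
        using False by (intro mult_right_mono) (auto simp: \<delta>_def)
      thus ?thesis
        using False by (simp add: algebra_simps max_def abs_if add_divide_distrib diff_divide_distrib)
    qed
  qed (use p in simp)
  also have "\<dots> = (p powi i) powr (\<beta> - 1) * (p powr - \<delta>) powr of_int \<bar>m - i\<bar>"
    using p by (simp add: powi_powr powr_powr flip: powr_add)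
  finally show ?thesis .
qed

text \<open>On the integers of one sign the map to |m| is injective, so each half of F is dominated
  by one geometric series.\<close>

lemma sum_geometric_abs_int_le:
  fixes \<rho> :: real
  assumes "0 < \<rho>" "\<rho> < 1" "finite F"
  shows "(\<Sum>m\<in>F. \<rho> ^ nat \<bar>m\<bar>) \<le> 2 / (1 - \<rho>)"
proof -
  have geom: "(\<Sum>m\<in>G. \<rho> ^ nat \<bar>m\<bar>) \<le> 1 / (1 - \<rho>)"
    if G: "finite G" "inj_on (\<lambda>m. nat \<bar>m\<bar>) G" for G
  proof -
    have "(\<Sum>m\<in>G. \<rho> ^ nat \<bar>m\<bar>) = (\<Sum>k\<in>(\<lambda>m. nat \<bar>m\<bar>) ` G. \<rho> ^ k)"
      using G(2) by (simp add: sum.reindex)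
    also have "\<dots> \<le> (\<Sum>k. \<rho> ^ k)"
      using assms G(1) by (intro sum_le_suminf summable_geometric) auto
    also have "\<dots> = 1 / (1 - \<rho>)"
      using assms by (intro suminf_geometric) auto
    finally show ?thesis .
  qed
  have "(\<Sum>m\<in>F. \<rho> ^ nat \<bar>m\<bar>) =
      (\<Sum>m\<in>{m\<in>F. m \<ge> 0}. \<rho> ^ nat \<bar>m\<bar>) + (\<Sum>m\<in>{m\<in>F. \<not> m \<ge> 0}. \<rho> ^ nat \<bar>m\<bar>)"
    using assms(3) by (subst sum.union_disjoint[symmetric]) (auto intro: sum.cong)
  also have "\<dots> \<le> 1 / (1 - \<rho>) + 1 / (1 - \<rho>)"
    using assms(3) by (intro add_mono geom) (auto simp: inj_on_def)
  finally show ?thesis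
    by simp
qed

text \<open>Decompositions are indexed by naturals, so \<open>int_decode\<close> enumerates the
  radii. It stays injective after a shift by i, hence the bound does not depend on i.\<close>

lemma suminf_geometric_int_decode_le:
  fixes \<rho> :: real
  assumes \<rho>: "0 < \<rho>" "\<rho> < 1"
  shows "(\<Sum>k. ennreal (\<rho> ^ nat \<bar>int_decode k - i\<bar>)) \<le> ennreal (2 / (1 - \<rho>))"
proof (rule suminf_le_const)
  fix n
  have inj: "inj_on (\<lambda>k. int_decode k - i) {..<n}"
    using inj_int_decode by (auto simp: inj_on_def)
  have "(\<Sum>k<n. ennreal (\<rho> ^ nat \<bar>int_decode k - i\<bar>)) =
      ennreal (\<Sum>m\<in>(\<lambda>k. int_decode k - i) ` {..<n}. \<rho> ^ nat \<bar>m\<bar>)"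
    using \<rho> by (simp add: sum.reindex[OF inj])
  also have "\<dots> \<le> ennreal (2 / (1 - \<rho>))"
    by (intro ennreal_leI sum_geometric_abs_int_le \<rho>) simp
  finally show "(\<Sum>k<n. ennreal (\<rho> ^ nat \<bar>int_decode k - i\<bar>)) \<le> ennreal (2 / (1 - \<rho>))" .
qed auto

text \<open>With \<open>\<beta> = 1 / r + \<alpha>\<close> this is a block: the \<open>L\<^sup>r\<close> norm of the sphere's indicator is at most \<open>p\<^bsup>m/r\<^esup>\<close>.\<close>

definition sphere_block :: "real \<Rightarrow> int \<Rightarrow> 'p::prime_card padic \<Rightarrow> complex" where
  "sphere_block \<beta> m x =
     (if padic_abs x = real CARD('p) powi m then of_real (real CARD('p) powr (- of_int m * \<beta>)) else 0)"

lemma borel_measurable_sphere_block [measurable]: "sphere_block \<beta> m \<in> borel_measurable borel"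
  unfolding sphere_block_def[abs_def] by measurable

lemma central_block_sphere_block:
  fixes M :: "'p::prime_card padic measure"
  assumes M: "padic_haar_measure M" and r: "1 < r"
  shows "central_block M r \<alpha> (sphere_block (1 / r + \<alpha>) m)"
  unfolding central_block_def
proof (intro exI[of _ m] conjI)
  let ?P = "real CARD('p)" and ?b = "sphere_block (1 / r + \<alpha>) m :: 'p padic \<Rightarrow> complex"
  have P: "?P > 1"
    by (rule card_gt_1)
  have "{x. x \<noteq> 0 \<and> ?b x \<noteq> 0} \<subseteq> padic_ball m"
    by (auto simp: sphere_block_def padic_ball_def split: if_splits)
  hence "closure {x. x \<noteq> 0 \<and> ?b x \<noteq> 0} \<subseteq> padic_ball m"
    by (rule closure_minimal[OF _ closed_padic_ball])
  thus "punctured_supp ?b \<subseteq> padic_ball m"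
    by (auto simp: punctured_supp_def)
  have sets [measurable_cong]: "sets M = sets borel"
    using M by (simp add: padic_haar_measure_def)
  have meas [measurable]: "?b \<in> borel_measurable (punctured M)"
    by (intro measurable_punctured[OF M]) measurable
  define A where "A = ?P powr (- of_int m * (1 / r + \<alpha>) * r)"
  have "(\<integral>\<^sup>+x. ennreal (cmod (?b x) powr r) \<partial>punctured M) \<le>
      (\<integral>\<^sup>+x. ennreal (cmod (?b x) powr r) \<partial>M)"
    by (rule nn_integral_punctured_le[OF M])
  \<comment> \<open>A is the r-th power of the value on the sphere. Its 1/r part will cancel the
    measure p^m of the enclosing ball and leave the block bound.\<close>
  also have "\<dots> \<le> (\<integral>\<^sup>+x. ennreal A * indicator (padic_ball m) x \<partial>M)"
    by (intro nn_integral_mono) (auto simp: sphere_block_def padic_ball_def powr_powr A_def)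
  also have "\<dots> = ennreal (A * ?P powi m)"
    using P by (simp add: nn_integral_cmult_indicator emeasure_padic_ball[OF M] A_def flip: ennreal_mult)
  also have "A * ?P powi m = ?P powr (- of_int m * (1 / r + \<alpha>) * r + of_int m)"
    using P powi_powr[of ?P m 1] by (simp only: A_def powr_add) simp
  also have "- of_int m * (1 / r + \<alpha>) * r + of_int m = - of_int m * \<alpha> * r"
    using r by (simp add: field_simps)
  finally have le: "(\<integral>\<^sup>+x. ennreal (cmod (?b x) powr r) \<partial>punctured M) \<le>
      ennreal (?P powr (- of_int m * \<alpha> * r))" .
  hence int: "integrable (punctured M) (\<lambda>x. cmod (?b x) powr r)"
    by (intro integrableI_bounded) (auto intro: le_less_trans)
  thus "in_Lr (punctured M) r ?b"
    by (simp add: in_Lr_def)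
  have "(\<integral>x. cmod (?b x) powr r \<partial>punctured M) \<le> ?P powr (- of_int m * \<alpha> * r)"
    using le by (simp add: nn_integral_eq_integral[OF int])
  hence "Lr_norm (punctured M) r ?b \<le> (?P powr (- of_int m * \<alpha> * r)) powr (1 / r)"
    using r unfolding Lr_norm_def by (intro powr_mono2) auto
  also have "\<dots> = (?P powi m) powr (- \<alpha>)"
    using r P by (simp add: powr_powr powi_powr)
  also have "?P powi m = measure M (padic_ball m :: 'p padic set)"
    using P by (simp add: measure_def emeasure_padic_ball[OF M])
  finally show "Lr_norm (punctured M) r ?b \<le> measure M (padic_ball m :: 'p padic set) powr (- \<alpha>)" .
qed

text \<open>A Schur-type estimate: \<open>lo\<close> and \<open>hi\<close> together say that
  \<delta> > 0, so the terms decay on both sides of the sphere of y with ratio \<rho> < 1.\<close>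

lemma radial_kernel_column_sum:
  fixes l \<beta> :: real
  assumes lo: "- (l / 2) < \<beta>" and hi: "\<beta> < l / 2 + 1"
  obtains G where "G > 0"
    "\<And>y :: 'p::prime_card padic. y \<noteq> 0 \<Longrightarrow>
      (\<Sum>k. ennreal (real CARD('p) powr (of_int (int_decode k) * \<beta>) *
        radial_kernel l (real CARD('p) powi int_decode k) (padic_abs y)))
      \<le> ennreal (G * padic_abs y powr (\<beta> - 1))"
proof
  let ?P = "real CARD('p)"
  have P: "?P > 1"
    by (rule card_gt_1)
  define \<delta> where "\<delta> = min (\<beta> + l / 2) (l / 2 + 1 - \<beta>)"
  define \<rho> where "\<rho> = ?P powr - \<delta>"
  have \<rho>: "0 < \<rho>" "\<rho> < 1"
    using lo hi P by (auto simp: \<rho>_def \<delta>_def powr_minus inverse_less_1_iff)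
  thus "2 / (1 - \<rho>) > 0"
    by simp
  fix y :: "'p padic"
  assume "y \<noteq> 0"
  then obtain i where i: "padic_abs y = ?P powi i"
    by (rule padic_abs_values)
  have "(\<Sum>k. ennreal (?P powr (of_int (int_decode k) * \<beta>) *
      radial_kernel l (?P powi int_decode k) (padic_abs y))) \<le>
      (\<Sum>k. ennreal (padic_abs y powr (\<beta> - 1)) * ennreal (\<rho> ^ nat \<bar>int_decode k - i\<bar>))"
  proof (intro suminf_le)
    fix k
    have "?P powr (of_int (int_decode k) * \<beta>) * radial_kernel l (?P powi int_decode k) (padic_abs y) \<le>
        padic_abs y powr (\<beta> - 1) * \<rho> powr of_int \<bar>int_decode k - i\<bar>"
      unfolding i \<rho>_def \<delta>_def by (rule radial_kernel_powi_le[OF P])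
    also have "\<rho> powr of_int \<bar>int_decode k - i\<bar> = \<rho> ^ nat \<bar>int_decode k - i\<bar>"
      using \<rho> by (simp flip: powr_realpow)
    finally show "ennreal (?P powr (of_int (int_decode k) * \<beta>) *
        radial_kernel l (?P powi int_decode k) (padic_abs y)) \<le>
        ennreal (padic_abs y powr (\<beta> - 1)) * ennreal (\<rho> ^ nat \<bar>int_decode k - i\<bar>)"
      using \<rho> by (simp add: ennreal_leI flip: ennreal_mult)
  qed auto
  also have "\<dots> \<le> ennreal (padic_abs y powr (\<beta> - 1)) * ennreal (2 / (1 - \<rho>))"
    by (simp add: mult_left_mono suminf_geometric_int_decode_le[OF \<rho>])
  also have "\<dots> = ennreal (2 / (1 - \<rho>) * padic_abs y powr (\<beta> - 1))"
    using \<rho> by (simp add: mult.commute flip: ennreal_mult)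
  finally show "(\<Sum>k. ennreal (?P powr (of_int (int_decode k) * \<beta>) *
      radial_kernel l (?P powi int_decode k) (padic_abs y))) \<le>
      ennreal (2 / (1 - \<rho>) * padic_abs y powr (\<beta> - 1))" .
qed

section \<open>Coefficients of the image along the spheres\<close>

text \<open>The common value of the image on the sphere of radius u.\<close>

definition radial_D :: "'p::prime_card padic measure \<Rightarrow> real \<Rightarrow> ('p padic \<Rightarrow> complex) \<Rightarrow> real \<Rightarrow> complex" where
  "radial_D M l f u = (\<integral>y. complex_of_real (radial_kernel l u (padic_abs y)) * f y \<partial>punctured M)"

lemma D_op_eq_radial: "D_op M l f x = radial_D M l f (padic_abs x)"
  by (simp add: D_op_def radial_D_def D_kernel_eq_radial)

text \<open>Tonelli exchanges the sum over spheres with the integral over y, and the column bound is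
  inserted under the integral. The power of p in \<open>c\<close> offsets the inverse power in
  \<open>sphere_block\<close>.\<close>

lemma radial_D_coefficients:
  fixes M :: "'p::prime_card padic measure" and G :: real
  assumes M: "padic_haar_measure M" and f [measurable]: "f \<in> borel_measurable (punctured M)"
    and G: "G \<ge> 0" "\<And>y :: 'p padic. y \<noteq> 0 \<Longrightarrow>
      (\<Sum>k. ennreal (real CARD('p) powr (of_int (int_decode k) * \<beta>) *
        radial_kernel l (real CARD('p) powi int_decode k) (padic_abs y)))
      \<le> ennreal (G * padic_abs y powr (\<beta> - 1))"
    and T: "T \<ge> 0" "(\<integral>\<^sup>+y. ennreal (padic_abs y powr (\<beta> - 1) * cmod (f y)) \<partial>punctured M) \<le> ennreal T"
  defines "c \<equiv> \<lambda>k. of_real (real CARD('p) powr (of_int (int_decode k) * \<beta>)) *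
      radial_D M l f (real CARD('p) powi int_decode k)"
  shows "integrable (punctured M)
      (\<lambda>y. complex_of_real (radial_kernel l (real CARD('p) powi m) (padic_abs y)) * f y)"
    and "summable (\<lambda>k. cmod (c k))" and "(\<Sum>k. cmod (c k)) \<le> G * T"
proof -
  let ?P = "real CARD('p)"
  have P: "?P > 1"
    by (rule card_gt_1)
  have [measurable]: "padic_abs \<in> borel_measurable (punctured M)"
    by (intro measurable_punctured[OF M]) measurable
  have [measurable]: "(\<lambda>y. radial_kernel l u (padic_abs y)) \<in> borel_measurable (punctured M)" for u
    unfolding radial_kernel_def by measurable
  \<comment> \<open>Absolute integrals in the extended reals: finiteness of \<open>J k\<close> gives
    integrability, and its value bounds the coefficient.\<close>
  define J where "J k = (\<integral>\<^sup>+y. ennreal (cmod (complex_of_real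
      (radial_kernel l (?P powi int_decode k) (padic_abs y)) * f y)) \<partial>punctured M)" for k
  define e where "e k = ?P powr (of_int (int_decode k) * \<beta>)" for k
  have e: "e k > 0" for k
    using P by (simp add: e_def)
  have "(\<Sum>k. ennreal (e k) * J k) = (\<integral>\<^sup>+y. (\<Sum>k. ennreal (e k) * ennreal (cmod (complex_of_real
      (radial_kernel l (?P powi int_decode k) (padic_abs y)) * f y))) \<partial>punctured M)"
    by (simp add: J_def nn_integral_suminf nn_integral_cmult)
  also have "\<dots> \<le> (\<integral>\<^sup>+y. ennreal G * ennreal (padic_abs y powr (\<beta> - 1) * cmod (f y)) \<partial>punctured M)"
  proof (rule nn_integral_mono)
    fix y
    assume "y \<in> space (punctured M)"
    hence y: "y \<noteq> 0"
      by (simp add: space_punctured[OF M])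
    have "(\<Sum>k. ennreal (e k) * ennreal (cmod (complex_of_real
        (radial_kernel l (?P powi int_decode k) (padic_abs y)) * f y))) =
        (\<Sum>k. ennreal (e k * radial_kernel l (?P powi int_decode k) (padic_abs y)) * ennreal (cmod (f y)))"
      using e by (intro suminf_cong)
        (simp add: norm_mult radial_kernel_nonneg less_imp_le mult.assoc flip: ennreal_mult)
    also have "\<dots> = (\<Sum>k. ennreal (e k * radial_kernel l (?P powi int_decode k) (padic_abs y))) *
        ennreal (cmod (f y))"
      by simp
    also have "\<dots> \<le> ennreal (G * padic_abs y powr (\<beta> - 1)) * ennreal (cmod (f y))"
      unfolding e_def by (intro mult_right_mono G(2) y) simp
    also have "\<dots> = ennreal G * ennreal (padic_abs y powr (\<beta> - 1) * cmod (f y))"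
      using G(1) by (simp add: mult.assoc flip: ennreal_mult)
    finally show "(\<Sum>k. ennreal (e k) * ennreal (cmod (complex_of_real
        (radial_kernel l (?P powi int_decode k) (padic_abs y)) * f y))) \<le>
        ennreal G * ennreal (padic_abs y powr (\<beta> - 1) * cmod (f y))" .
  qed
  also have "\<dots> \<le> ennreal G * ennreal T"
    by (simp add: nn_integral_cmult mult_left_mono T(2))
  also have "\<dots> = ennreal (G * T)"
    using G(1) T(1) by (simp add: ennreal_mult)
  finally have total: "(\<Sum>k. ennreal (e k) * J k) \<le> ennreal (G * T)" .
  have bound: "ennreal (e k) * J k \<le> ennreal (G * T)" for k
    using sum_le_suminf[of "\<lambda>k. ennreal (e k) * J k" "{k}"] order_trans[OF _ total] by simp
  \<comment> \<open>Each term of the finite total is finite, and its factor \<open>e k\<close> is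
    positive.\<close>
  have J: "J k < \<infinity>" for k
    using bound[of k] e[of k] by (auto simp: less_top[symmetric] ennreal_top_mult ennreal_mult_top top_unique)
  have int: "integrable (punctured M) (\<lambda>y. complex_of_real
      (radial_kernel l (?P powi int_decode k) (padic_abs y)) * f y)" for k
    using J[of k] by (intro integrableI_bounded) (auto simp: J_def)
  show "integrable (punctured M)
      (\<lambda>y. complex_of_real (radial_kernel l (real CARD('p) powi m) (padic_abs y)) * f y)"
    using int[of "int_encode m"] by simp
  have "ennreal (cmod (c k)) \<le> ennreal (e k) * J k" for k
  proof -
    have "ennreal (cmod (radial_D M l f (?P powi int_decode k))) \<le> J k"
      unfolding radial_D_def J_def by (rule integral_norm_bound_ennreal[OF int])
    thus ?thesis
      using e[of k] by (simp add: c_def norm_mult ennreal_mult mult_left_mono flip: e_def)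
  qed
  hence "(\<Sum>k. ennreal (cmod (c k))) \<le> (\<Sum>k. ennreal (e k) * J k)"
    by (intro suminf_le) auto
  also note total
  finally have csum: "(\<Sum>k. ennreal (cmod (c k))) \<le> ennreal (G * T)" .
  thus sm: "summable (\<lambda>k. cmod (c k))"
    by (intro summable_suminf_not_top) (auto simp: top_unique)
  show "(\<Sum>k. cmod (c k)) \<le> G * T"
    using csum G(1) T(1) by (simp add: suminf_ennreal2 sm)
qed

text \<open>Only the sphere through x contributes, and there the two powers of p cancel.\<close>

lemma D_op_sums_sphere_blocks:
  fixes x :: "'p::prime_card padic"
  assumes "x \<noteq> 0"
  shows "(\<lambda>k. of_real (real CARD('p) powr (of_int (int_decode k) * \<beta>)) *
      radial_D M l f (real CARD('p) powi int_decode k) * sphere_block \<beta> (int_decode k) x)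
    sums D_op M l f x"
proof -
  let ?P = "real CARD('p)"
  have P: "?P > 1"
    by (rule card_gt_1)
  obtain m where m: "padic_abs x = ?P powi m"
    using assms by (rule padic_abs_values)
  let ?t = "\<lambda>k. of_real (?P powr (of_int (int_decode k) * \<beta>)) *
      radial_D M l f (?P powi int_decode k) * sphere_block \<beta> (int_decode k) x"
  have "?t k = 0" if "k \<noteq> int_encode m" for k
  proof -
    have "m \<noteq> int_decode k"
      using that by auto
    hence "?P powi m \<noteq> ?P powi int_decode k"
      using powi_less_iff[OF P] by (metis linorder_neqE less_irrefl)
    thus ?thesis
      by (simp add: sphere_block_def m)
  qed
  moreover have "?t (int_encode m) = D_op M l f x"
  proof -
    have "?P powr (of_int m * \<beta>) * ?P powr (- (of_int m * \<beta>)) = 1"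
      using P by (simp flip: powr_add)
    hence "complex_of_real (?P powr (of_int m * \<beta>)) * complex_of_real (?P powr (- (of_int m * \<beta>))) = 1"
      by (simp flip: of_real_mult)
    thus ?thesis
      by (simp add: sphere_block_def D_op_eq_radial m)
  qed
  ultimately show ?thesis
    using sums_finite[of "{int_encode m}" ?t] by auto
qed

section \<open>The image in the block space and the norm bound\<close>

text \<open>T is any bound for the weighted integral, so one G serves every f and every
  decomposition of it. Local integrability holds because the image is bounded on compact sets
  avoiding 0.\<close>

lemma D_op_block_decomposition:
  fixes M :: "'p::prime_card padic measure" and \<alpha> r l :: real
  assumes M: "padic_haar_measure M" and r: "1 < r" and \<alpha>: "0 < \<alpha>"
    and lo: "- (l / 2) < 1 / r + \<alpha>" and hi: "1 / r + \<alpha> < l / 2 + 1"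
  obtains G where "G > 0"
    "\<And>f T. f \<in> borel_measurable (punctured M) \<Longrightarrow> T \<ge> 0 \<Longrightarrow>
      (\<integral>\<^sup>+y. ennreal (padic_abs y powr (1 / r + \<alpha> - 1) * cmod (f y)) \<partial>punctured M) \<le> ennreal T \<Longrightarrow>
      (\<forall>x. x \<noteq> 0 \<longrightarrow> integrable (punctured M) (\<lambda>y. complex_of_real (D_kernel l x y) * f y)) \<and>
      in_Lr_loc M r (D_op M l f) \<and>
      (\<exists>c a. block_decomposition M r \<alpha> (D_op M l f) c a \<and> (\<Sum>k. cmod (c k)) \<le> G * T)"
proof -
  let ?P = "real CARD('p)"
  have P: "?P > 1"
    by (rule card_gt_1)
  define \<beta> where "\<beta> = 1 / r + \<alpha>"
  have \<beta>: "\<beta> > 0"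
    using r \<alpha> by (simp add: \<beta>_def add_pos_pos)
  obtain G where G: "G > 0" "\<And>y :: 'p padic. y \<noteq> 0 \<Longrightarrow>
      (\<Sum>k. ennreal (?P powr (of_int (int_decode k) * \<beta>) *
        radial_kernel l (?P powi int_decode k) (padic_abs y)))
      \<le> ennreal (G * padic_abs y powr (\<beta> - 1))"
    using radial_kernel_column_sum[OF lo hi] unfolding \<beta>_def by blast
  show thesis
  proof (rule that[OF G(1)])
    fix f :: "'p padic \<Rightarrow> complex" and T
    assume f [measurable]: "f \<in> borel_measurable (punctured M)" and T: "T \<ge> 0"
      "(\<integral>\<^sup>+y. ennreal (padic_abs y powr (1 / r + \<alpha> - 1) * cmod (f y)) \<partial>punctured M) \<le> ennreal T"
    define c where "c k = of_real (?P powr (of_int (int_decode k) * \<beta>)) *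
        radial_D M l f (?P powi int_decode k)" for k
    note coeff = radial_D_coefficients[OF M f less_imp_le[OF G(1)] G(2) T(1) T(2)[folded \<beta>_def],
        folded c_def]
    note sums = D_op_sums_sphere_blocks[where \<beta> = \<beta> and M = M and l = l and f = f, folded c_def]
    have "integrable (punctured M) (\<lambda>y. complex_of_real (D_kernel l x y) * f y)"
      if "x \<noteq> 0" for x
      using padic_abs_values[OF that] coeff(1) by (metis (no_types, lifting) D_kernel_eq_radial
          Bochner_Integration.integrable_cong)
    moreover have "block_decomposition M r \<alpha> (D_op M l f) c (\<lambda>k. sphere_block \<beta> (int_decode k))"
      using coeff(2) sums by (auto simp: block_decomposition_def \<beta>_def space_punctured[OF M]
          intro!: central_block_sphere_block[OF M r] AE_I2)
    moreover have "in_Lr_loc M r (D_op M l f)"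
      unfolding in_Lr_loc_def
    proof (intro conjI allI impI)
      have [measurable]: "sphere_block \<beta> m \<in> borel_measurable (punctured M)" for m
        by (intro measurable_punctured[OF M]) measurable
      \<comment> \<open>Measurability is read off from the series of sphere blocks, which equals the
        image away from 0.\<close>
      have "(\<lambda>x. \<Sum>k. c k * sphere_block \<beta> (int_decode k) x) \<in> borel_measurable (punctured M)"
        by measurable
      also have "?this \<longleftrightarrow> D_op M l f \<in> borel_measurable (punctured M)"
        by (intro measurable_cong) (simp add: space_punctured[OF M] sums_unique[OF sums])
      finally show D_meas [measurable]: "D_op M l f \<in> borel_measurable (punctured M)" .
      fix K :: "'p padic set"
      assume K: "compact K \<and> K \<subseteq> - {0}"
      \<comment> \<open>K lies in a shell: the inner radius \<epsilon> bounds the image on K, the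
        outer radius R puts K into a ball of finite measure.\<close>
      have "open (- K)" "0 \<in> - K"
        using K by (auto intro: compact_imp_closed)
      then obtain \<epsilon> where \<epsilon>: "\<epsilon> > 0" "ball 0 \<epsilon> \<subseteq> - K"
        using open_contains_ball by blast
      obtain R where R: "\<And>x. x \<in> K \<Longrightarrow> padic_abs x \<le> R"
        using compact_imp_bounded[of K] K by (auto simp: bounded_any_center[of _ 0] dist_padic_def)
      obtain N where N: "R < ?P ^ N"
        using real_arch_pow[OF P] by blast
      have sub: "K \<subseteq> padic_ball (int N)"
        using R N by (fastforce simp: padic_ball_def)
      have bound: "cmod (D_op M l f x) \<le> (\<Sum>k. cmod (c k)) * \<epsilon> powr (- \<beta>)" if "x \<in> K" for x
      proof -
        have x: "x \<noteq> 0"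
          using that K by auto
        then obtain m where m: "padic_abs x = ?P powi m"
          by (rule padic_abs_values)
        have "\<epsilon> \<le> padic_abs x"
          using \<epsilon>(2) that by (force simp: dist_padic_def)
        hence le: "padic_abs x powr (- \<beta>) \<le> \<epsilon> powr (- \<beta>)"
          using \<epsilon>(1) \<beta> by (intro powr_mono2') auto
        \<comment> \<open>\<open>c (int_encode m)\<close> is the value at x times p^(m\<beta>),
          where p^m = |x|; one coefficient is at most the full sum.\<close>
        have "cmod (D_op M l f x) = cmod (c (int_encode m)) * padic_abs x powr (- \<beta>)"
          using P by (simp add: c_def D_op_eq_radial m norm_mult powi_powr powr_minus)
        also have "\<dots> \<le> (\<Sum>k. cmod (c k)) * \<epsilon> powr (- \<beta>)"
          using sum_le_suminf[OF coeff(2), of "{int_encode m}"] le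
          by (intro mult_mono suminf_nonneg coeff(2)) auto
        finally show ?thesis .
      qed
      have K_sets: "K \<in> sets (punctured M)"
        using K M borel_closed[OF compact_imp_closed, of K]
        by (auto simp: punctured_def sets_restrict_space padic_haar_measure_def image_iff
            intro!: bexI[of _ K])
      have "emeasure (punctured M) K = emeasure M K"
        unfolding punctured_def using K M
        by (intro emeasure_restrict_space) (auto simp: padic_haar_measure_def
            dest!: sets_eq_imp_space_eq)
      also have "\<dots> \<le> emeasure M (padic_ball (int N))"
        using M by (intro emeasure_mono sub) (simp add: padic_haar_measure_def)
      also have "\<dots> < \<infinity>"
        by (simp add: emeasure_padic_ball[OF M])
      finally have fin: "emeasure (punctured M) K < \<infinity>" .
      show "set_integrable (punctured M) K (\<lambda>x. cmod (D_op M l f x) powr r)"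
        unfolding set_integrable_def
      proof (rule integrableI_bounded_set[OF K_sets _ fin])
        show "AE x in punctured M. x \<in> K \<longrightarrow> norm (indicat_real K x *\<^sub>R cmod (D_op M l f x) powr r) \<le>
            ((\<Sum>k. cmod (c k)) * \<epsilon> powr (- \<beta>)) powr r"
          using bound r by (intro AE_I2) (auto intro!: powr_mono2)
        show "(\<lambda>x. indicat_real K x *\<^sub>R cmod (D_op M l f x) powr r) \<in> borel_measurable (punctured M)"
          using K_sets by measurable
      qed auto
    qed
    ultimately show "(\<forall>x. x \<noteq> 0 \<longrightarrow>
          integrable (punctured M) (\<lambda>y. complex_of_real (D_kernel l x y) * f y)) \<and>
        in_Lr_loc M r (D_op M l f) \<and>
        (\<exists>c a. block_decomposition M r \<alpha> (D_op M l f) c a \<and> (\<Sum>k. cmod (c k)) \<le> G * T)"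
      using coeff(3) by blast
  qed
qed

text \<open>Two conjuncts exclude default values: a Bochner integral is 0 when the integrand is not
  integrable, and the infimum defining \<open>block_norm\<close> says nothing when no decomposition
  exists.\<close>

theorem theorem3p5:
  fixes M :: "'p::prime_card padic measure" and r \<alpha> l :: real
  assumes "padic_haar_measure M"
    and "1 < r" and "0 < \<alpha>" and "0 \<le> l"
    and "- (l / 2) < 1 / r + \<alpha>" and "1 / r + \<alpha> < l / 2 + 1"
  shows "\<exists>C>0. \<forall>f\<in>block_space M r \<alpha>.
    (\<forall>x. x \<noteq> 0 \<longrightarrow> integrable (punctured M) (\<lambda>y. complex_of_real (D_kernel l x y) * f y)) \<and>
    D_op M l f \<in> block_space M r \<alpha> \<and>
    block_norm M r \<alpha> (D_op M l f) \<le> C * block_norm M r \<alpha> f"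
proof -
  let ?w = "\<lambda>x :: 'p padic. padic_abs x powr (1 / r + \<alpha> - 1)"
  obtain B where B: "B > 0" "\<And>a. central_block M r \<alpha> a \<Longrightarrow>
      (\<integral>\<^sup>+x. ennreal (?w x * cmod (a x)) \<partial>punctured M) \<le> ennreal B"
    using central_block_weighted_bound[OF assms(1-3)] by blast
  obtain G where G: "G > 0" "\<And>f T. f \<in> borel_measurable (punctured M) \<Longrightarrow> T \<ge> 0 \<Longrightarrow>
      (\<integral>\<^sup>+y. ennreal (?w y * cmod (f y)) \<partial>punctured M) \<le> ennreal T \<Longrightarrow>
      (\<forall>x. x \<noteq> 0 \<longrightarrow> integrable (punctured M) (\<lambda>y. complex_of_real (D_kernel l x y) * f y)) \<and>
      in_Lr_loc M r (D_op M l f) \<and>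
      (\<exists>c a. block_decomposition M r \<alpha> (D_op M l f) c a \<and> (\<Sum>k. cmod (c k)) \<le> G * T)"
    using D_op_block_decomposition[OF assms(1-3,5,6)] by blast
  have w: "?w \<in> borel_measurable (punctured M)"
    by (intro measurable_punctured[OF assms(1)]) measurable
  \<comment> \<open>Stated for every decomposition of f with the same \<open>G * B\<close>, so that
    it applies to each competitor in the infimum.\<close>
  have main: "(\<forall>x. x \<noteq> 0 \<longrightarrow>
        integrable (punctured M) (\<lambda>y. complex_of_real (D_kernel l x y) * f y)) \<and>
      in_Lr_loc M r (D_op M l f) \<and>
      (\<exists>c' a'. block_decomposition M r \<alpha> (D_op M l f) c' a' \<and>
        (\<Sum>k. cmod (c' k)) \<le> G * B * (\<Sum>k. cmod (c k)))"
    if "f \<in> borel_measurable (punctured M)" and dec: "block_decomposition M r \<alpha> f c a" for f c a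
    using G(2)[OF that(1) _ decomposition_weighted_bound[OF B(2) _ _ w dec]] B(1) dec
    by (auto simp: mult.assoc block_decomposition_def suminf_nonneg)
  show ?thesis
  proof (intro exI[of _ "G * B"] conjI ballI)
    show GB: "G * B > 0"
      using G(1) B(1) by simp
    fix f
    assume f: "f \<in> block_space M r \<alpha>"
    then obtain c a where dec: "block_decomposition M r \<alpha> f c a" and
      f_meas: "f \<in> borel_measurable (punctured M)"
      by (auto simp: block_space_def in_Lr_loc_def)
    note 1 = main[OF f_meas dec]
    show "\<forall>x. x \<noteq> 0 \<longrightarrow> integrable (punctured M) (\<lambda>y. complex_of_real (D_kernel l x y) * f y)"
      and "D_op M l f \<in> block_space M r \<alpha>"
      using 1 by (auto simp: block_space_def)
    \<comment> \<open>With the constant moved to the left, the claim is that a number is a lower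
      bound of the set whose infimum is the norm of f; \<open>dec\<close> shows this set to be
      nonempty.\<close>
    have "block_norm M r \<alpha> (D_op M l f) / (G * B) \<le> block_norm M r \<alpha> f"
      unfolding block_norm_def[of M r \<alpha> f]
    proof (rule cInf_greatest)
      fix S
      assume "S \<in> {\<Sum>k. cmod (c k) |c a. block_decomposition M r \<alpha> f c a}"
      then obtain c a where S: "S = (\<Sum>k. cmod (c k))" and dec: "block_decomposition M r \<alpha> f c a"
        by auto
      obtain c' a' where c': "block_decomposition M r \<alpha> (D_op M l f) c' a'"
        "(\<Sum>k. cmod (c' k)) \<le> G * B * S"
        using main[OF f_meas dec] S by blast
      have "block_norm M r \<alpha> (D_op M l f) \<le> (\<Sum>k. cmod (c' k))"
        unfolding block_norm_def using c'(1)
        by (intro cInf_lower bdd_belowI[of _ 0])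
          (auto simp: block_decomposition_def intro!: suminf_nonneg)
      also note c'(2)
      finally show "block_norm M r \<alpha> (D_op M l f) / (G * B) \<le> S"
        using GB by (simp add: field_simps)
    qed (use dec in blast)
    thus "block_norm M r \<alpha> (D_op M l f) \<le> G * B * block_norm M r \<alpha> f"
      using GB by (simp add: field_simps)
  qed
qed

end
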